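(* Let $p\ge 3$ be a prime number and let $G=(V,E)$ be a $(6p-8)(p-1)$-edge-connected graph. For any mapping $f:E\to\mathbb{Z}_p\setminus\{0\}$ and any $\mathbb{Z}_p$-boundary $\beta$ of $G$, the graph $G$ has an $f$-weighted $\beta$-orientation.
   Context: Graphs are finite and may have multiple edges but no loops. A $\mathbb{Z}_k$-boundary of $G=(V,E)$ is a map $\beta:V\to\mathbb{Z}_k$ with $\sum_{v\in V}\beta(v)\equiv 0\pmod k$. An orientation $\vec G$ of $G$ gives each edge a direction; for $v\in V$, $\delta^+_{\vec G}(v)$ (resp. $\delta^-_{\vec G}(v)$) is the set of arcs leaving (resp. entering) $v$. Given $f:E\to\mathbb{Z}_k$, write $\partial f(v)=\sum_{\vec e\in\delta^+_{\vec G}(v)}f(e)-\sum_{\vec e\in\delta^-_{\vec G}(v)}f(e)$. An orientation $\vec G$ is an $f$-weighted $\beta$-orientation if $\partial f(v)\equiv\beta(v)\pmod k$ for every $v\in V$. *)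

theory Defs
  imports Main "HOL-Computational_Algebra.Primes"
begin

text \<open>A finite loopless multigraph: vertex set V, edge set E (edges are abstract
objects, so parallel edges are allowed), and ends e = (u, w) the two (distinct)
endpoints of e, listed in an arbitrary reference order.\<close>

definition multigraph :: "'v set \<Rightarrow> 'e set \<Rightarrow> ('e \<Rightarrow> 'v \<times> 'v) \<Rightarrow> bool" where
  "multigraph V E ends \<longleftrightarrow> finite V \<and> finite E \<and>
     (\<forall>e\<in>E. fst (ends e) \<in> V \<and> snd (ends e) \<in> V \<and> fst (ends e) \<noteq> snd (ends e))"

definition edge_cut :: "'e set \<Rightarrow> ('e \<Rightarrow> 'v \<times> 'v) \<Rightarrow> 'v set \<Rightarrow> 'e set" where
  "edge_cut E ends X = {e\<in>E. (fst (ends e) \<in> X) \<noteq> (snd (ends e) \<in> X)}"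

definition edge_connected :: "nat \<Rightarrow> 'v set \<Rightarrow> 'e set \<Rightarrow> ('e \<Rightarrow> 'v \<times> 'v) \<Rightarrow> bool" where
  "edge_connected k V E ends \<longleftrightarrow>
     (\<forall>X. X \<subseteq> V \<and> X \<noteq> {} \<and> X \<noteq> V \<longrightarrow> card (edge_cut E ends X) \<ge> k)"

text \<open>An orientation assigns to each edge an ordered pair (tail, head) which is one
of the two orderings of its endpoints.\<close>
definition is_orientation :: "'e set \<Rightarrow> ('e \<Rightarrow> 'v \<times> 'v) \<Rightarrow> ('e \<Rightarrow> 'v \<times> 'v) \<Rightarrow> bool" where
  "is_orientation E ends D \<longleftrightarrow> (\<forall>e\<in>E. D e = ends e \<or> D e = prod.swap (ends e))"

definition boundary_of :: "'e set \<Rightarrow> ('e \<Rightarrow> 'v \<times> 'v) \<Rightarrow> ('e \<Rightarrow> int) \<Rightarrow> 'v \<Rightarrow> int" where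
  "boundary_of E D f v = (\<Sum>e\<in>{e\<in>E. fst (D e) = v}. f e) - (\<Sum>e\<in>{e\<in>E. snd (D e) = v}. f e)"

definition is_Zk_boundary :: "int \<Rightarrow> 'v set \<Rightarrow> ('v \<Rightarrow> int) \<Rightarrow> bool" where
  "is_Zk_boundary k V \<beta> \<longleftrightarrow> (\<forall>v\<in>V. \<beta> v \<in> {0..<k}) \<and> (\<Sum>v\<in>V. \<beta> v) mod k = 0"

definition weighted_beta_orientation ::
  "int \<Rightarrow> 'v set \<Rightarrow> 'e set \<Rightarrow> ('e \<Rightarrow> 'v \<times> 'v) \<Rightarrow> ('e \<Rightarrow> int) \<Rightarrow> ('v \<Rightarrow> int) \<Rightarrow> ('e \<Rightarrow> 'v \<times> 'v) \<Rightarrow> bool" where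
  "weighted_beta_orientation k V E ends f \<beta> D \<longleftrightarrow> is_orientation E ends D \<and>
     (\<forall>v\<in>V. boundary_of E D f v mod k = \<beta> v mod k)"

end

(* Among the (p - 1) / 2 classes of weights {c, -c}, one carries at least (6 p - 8) |V| edges, so by
   Mader's theorem it contains a (6 p - 7)-edge-connected subgraph on some S.  Contract S, orient the
   smaller graph by induction, and correct the boundary inside S using the edges of that class alone:
   up to a factor c this asks for an unweighted orientation with a prescribed boundary modulo p.

   That such orientations exist in (6 k - 7)-edge-connected graphs (k odd) follows the approach of
   Thomassen and of Lovasz, Thomassen, Wu and Zhang.  Parity turns the boundary modulo k into a target
   t modulo 2 k, and an edge joining a vertex with t > 0 to one with t < 0 may be oriented from the
   former to the latter and deleted.  A vertex with t = 0 is removed by lifting its edges in pairs,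
   and a cut of the smallest permitted size splits the problem in two.  If all targets have the same
   sign, 2 k is added to or subtracted from one of them; this costs at most 2 k - 2 in the degree
   condition of that vertex, and never are there more than two such vertices. *)

theory Submission
  imports Defs
begin

text \<open>The constants come from working backwards. K - 1 parallel edges realise every residue of
  the right parity modulo 2K, so two vertices joined by that many can be merged. On three vertices
  such a pair is forced as soon as the multiplicities sum to 3K - 5 = 3(K - 2) + 1. A vertex with a
  shifted target therefore gets the bound 3K - 5 + |t|; a shift may raise |t| by 2K - 2, so the
  other sets start from 5K - 7, and their residues add at most K, which gives 6K - 7. Two shifted
  vertices and one being dissolved make three; with a fourth vertex present, \<open>W\<close> itself
  stays in the higher case of \<open>demand\<close>, which is why shifts and dissolutions are begun
  only then.

  Parity enters because K is odd: \<open>demand\<close> and the cut then have the same parity, so a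
  cut that is not tight has two edges to spare, exactly what a lifting or a directed edge may
  consume.

  The obstacle to a plain induction is that splitting at a tight cut leaves a side whose boundary
  edges are already oriented. Hence the induction is about extending a partial orientation in which
  at most \<open>demand K (L \<union> Y) t W\<close> edges around \<open>W\<close> are
  fixed.\<close>

section \<open>Residues modulo 2K\<close>

text \<open>The distance from \<open>s\<close> to the nearest multiple of 2K.\<close>

definition circ_abs :: "int \<Rightarrow> int \<Rightarrow> int" where
  "circ_abs K s = min (s mod (2 * K)) (2 * K - s mod (2 * K))"

lemma circ_abs_rep:
  assumes "K > 0"
  shows "\<exists>r. 2 * K dvd r - s \<and> \<bar>r\<bar> = circ_abs K s \<and> \<bar>r\<bar> \<le> K"
proof -
  let ?m = "s mod (2 * K)"
  have b: "0 \<le> ?m" "?m < 2 * K" using assms by auto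
  have d: "2 * K dvd ?m - s" by (simp add: mod_eq_dvd_iff [symmetric])
  show ?thesis
  proof (cases "?m \<le> K")
    case True
    then show ?thesis using b d by (intro exI[of _ ?m]) (auto simp: circ_abs_def)
  next
    case False
    have "?m - 2 * K - s = (?m - s) - 2 * K" by simp
    then have "2 * K dvd ?m - 2 * K - s" using d by (metis dvd_diff dvd_refl)
    then show ?thesis using b False by (intro exI[of _ "?m - 2 * K"]) (auto simp: circ_abs_def)
  qed
qed

lemma circ_abs_cong: "2 * K dvd a - b \<Longrightarrow> circ_abs K a = circ_abs K b"
  unfolding circ_abs_def by (metis mod_eq_dvd_iff)

lemma circ_abs_le_abs:
  assumes "K > 0"
  shows "circ_abs K s \<le> \<bar>s\<bar>"
proof (cases "s \<ge> 0")
  case True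
  have "s mod (2 * K) \<le> s" using True assms by (simp add: zmod_le_nonneg_dividend)
  then show ?thesis using True by (auto simp: circ_abs_def)
next
  case False
  show ?thesis
  proof (cases "s mod (2 * K) = 0")
    case True then show ?thesis by (auto simp: circ_abs_def)
  next
    case nz: False
    have "(-s) mod (2 * K) = 2 * K - s mod (2 * K)" using nz by (simp add: zmod_zminus1_eq_if)
    moreover have "(-s) mod (2 * K) \<le> -s" using False assms by (simp add: zmod_le_nonneg_dividend)
    ultimately show ?thesis using False by (auto simp: circ_abs_def)
  qed
qed

lemma circ_abs_small:
  assumes "K > 0" "\<bar>s\<bar> \<le> K"
  shows "circ_abs K s = \<bar>s\<bar>"
proof (cases "s \<ge> 0")
  case True
  then have "s mod (2 * K) = s" using assms by simp
  then show ?thesis using True assms by (auto simp: circ_abs_def)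
next
  case False
  have "(s + 2 * K) mod (2 * K) = s + 2 * K"
    using assms False by (intro mod_pos_pos_trivial) auto
  then have "s mod (2 * K) = s + 2 * K" by simp
  then show ?thesis using False assms by (auto simp: circ_abs_def)
qed

lemma circ_abs_triangle:
  assumes "K > 0"
  shows "circ_abs K (a + b) \<le> circ_abs K a + circ_abs K b"
proof -
  obtain r q where r: "2 * K dvd r - a" "\<bar>r\<bar> = circ_abs K a" and q: "2 * K dvd q - b" "\<bar>q\<bar> = circ_abs K b"
    using circ_abs_rep[OF assms] by meson
  have "(r + q) - (a + b) = (r - a) + (q - b)" by simp
  then have "2 * K dvd (r + q) - (a + b)" using r(1) q(1) by (metis dvd_add)
  then have "circ_abs K (a + b) = circ_abs K (r + q)" using circ_abs_cong by metis
  also have "\<dots> \<le> \<bar>r + q\<bar>" using circ_abs_le_abs[OF assms] .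
  finally show ?thesis using r(2) q(2) by linarith
qed

lemma circ_abs_le:
  assumes "K > 0"
  shows "circ_abs K s \<le> K" "0 \<le> circ_abs K s"
  using circ_abs_rep[OF assms, of s] by auto

lemma circ_abs_even:
  assumes "K > 0"
  shows "even (circ_abs K s - s)"
proof -
  obtain r where r: "2 * K dvd r - s" "\<bar>r\<bar> = circ_abs K s" using circ_abs_rep[OF assms] by meson
  from r(1) have "even (r - s)" by (metis dvd_mult_left)
  then show ?thesis using r(2) by (metis even_abs_add_iff even_diff_iff even_add)
qed

text \<open>Beyond K the distance is 2K - |s|, so the gap is 2|s| - 2K, at most 2K - 2. This gap is
  the difference between the constants 5K - 7 and 3K - 5 of \<open>demand\<close>.\<close>

lemma abs_le_circ_abs:
  assumes "K > 0" "\<bar>s\<bar> \<le> 2 * K - 1"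
  shows "\<bar>s\<bar> \<le> circ_abs K s + (2 * K - 2)"
proof (cases "\<bar>s\<bar> \<le> K")
  case True
  then show ?thesis using circ_abs_small[OF assms(1) True] assms by auto
next
  case False
  define r where "r = (if s > 0 then s - 2 * K else s + 2 * K)"
  have "2 * K dvd s - r" by (auto simp: r_def)
  then have "circ_abs K s = circ_abs K r" by (rule circ_abs_cong)
  moreover have "\<bar>r\<bar> \<le> K" "\<bar>r\<bar> = 2 * K - \<bar>s\<bar>" using False assms by (auto simp: r_def)
  ultimately have "circ_abs K s = 2 * K - \<bar>s\<bar>" using circ_abs_small[OF assms(1)] by simp
  then show ?thesis using assms(2) by linarith
qed

section \<open>Cuts and outflow\<close>

definition cut :: "'e set \<Rightarrow> ('e \<Rightarrow> 'v \<times> 'v) \<Rightarrow> 'v set \<Rightarrow> int" where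
  "cut E g X = int (card (edge_cut E g X))"

text \<open>A weight of 1 or -1 encodes an orientation relative to the reference order
  \<open>g\<close>; a sign times an edge weight yields the weighted boundary. Loops cancel, so
  contraction may leave them in place.\<close>

definition outflow :: "'e set \<Rightarrow> ('e \<Rightarrow> 'v \<times> 'v) \<Rightarrow> ('e \<Rightarrow> int) \<Rightarrow> 'v set \<Rightarrow> int" where
  "outflow E g s X = (\<Sum>e\<in>E. s e * (of_bool (fst (g e) \<in> X) - of_bool (snd (g e) \<in> X)))"

definition between :: "'e set \<Rightarrow> ('e \<Rightarrow> 'v \<times> 'v) \<Rightarrow> 'v \<Rightarrow> 'v \<Rightarrow> 'e set" where
  "between E g x y = {e\<in>E. (fst (g e) = x \<and> snd (g e) = y) \<or> (fst (g e) = y \<and> snd (g e) = x)}"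

definition signs :: "'e set \<Rightarrow> ('e \<Rightarrow> int) \<Rightarrow> bool" where
  "signs E s \<longleftrightarrow> (\<forall>e\<in>E. s e = 1 \<or> s e = -1)"

lemma cut_sum:
  assumes "finite E"
  shows "cut E g X = (\<Sum>e\<in>E. of_bool ((fst (g e) \<in> X) \<noteq> (snd (g e) \<in> X)))"
  using assms by (simp add: cut_def edge_cut_def Int_def)

lemma outflow_cong:
  assumes "\<And>e. e \<in> E \<Longrightarrow> (fst (g e) \<in> X) \<noteq> (snd (g e) \<in> X) \<Longrightarrow> s e = s' e"
  shows "outflow E g s X = outflow E g s' X"
  unfolding outflow_def using assms by (intro sum.cong) auto

lemma outflow_singletons:
  assumes "finite X"
  shows "outflow E g s X = (\<Sum>x\<in>X. outflow E g s {x})"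
proof -
  have *: "of_bool (v \<in> X) = (\<Sum>x\<in>X. of_bool (v \<in> {x}) :: int)" for v
    using assms by (simp add: of_bool_def sum.delta')
  have "(\<Sum>x\<in>X. outflow E g s {x}) =
      (\<Sum>e\<in>E. \<Sum>x\<in>X. s e * (of_bool (fst (g e) \<in> {x}) - of_bool (snd (g e) \<in> {x})))"
    unfolding outflow_def by (rule sum.swap)
  also have "\<dots> = outflow E g s X"
    unfolding outflow_def *[of "fst _"] *[of "snd _"] sum_distrib_left[symmetric] sum_subtractf ..
  finally show ?thesis ..
qed

lemma outflow_even:
  assumes "finite E" "signs E s"
  shows "even (outflow E g s X - cut E g X)"
proof -
  have "outflow E g s X - cut E g X = (\<Sum>e\<in>E. s e * (of_bool (fst (g e) \<in> X) - of_bool (snd (g e) \<in> X))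
      - of_bool ((fst (g e) \<in> X) \<noteq> (snd (g e) \<in> X)))"
    using assms by (simp add: outflow_def cut_sum sum_subtractf)
  also have "even \<dots>"
    using assms(2) by (intro dvd_sum) (auto simp: signs_def)
  finally show ?thesis .
qed

lemma cut_even:
  assumes "finite E" "finite X"
  shows "even (cut E g X - (\<Sum>x\<in>X. cut E g {x}))"
proof -
  have s: "signs E (\<lambda>_. 1)" by (auto simp: signs_def)
  have "even (outflow E g (\<lambda>_. 1) X - cut E g X)" by (rule outflow_even[OF assms(1) s])
  moreover have "even (\<Sum>x\<in>X. outflow E g (\<lambda>_. 1) {x} - cut E g {x})"
    by (intro dvd_sum outflow_even[OF assms(1) s])
  ultimately show ?thesis
    using outflow_singletons[OF assms(2), of E g "\<lambda>_. 1"] by (simp add: sum_subtractf)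
qed

lemma outflow_le_cut:
  assumes "finite E" "signs E s"
  shows "\<bar>outflow E g s X\<bar> \<le> cut E g X"
  unfolding outflow_def cut_sum[OF assms(1)]
  using assms(2) by (intro order.trans[OF sum_abs] sum_mono) (auto simp: signs_def)

lemma cut_Un:
  assumes "finite E" "X \<inter> Y = {}"
  shows "cut E g (X \<union> Y) = cut E g X + cut E g Y
    - 2 * int (card {e\<in>E. (fst (g e) \<in> X \<and> snd (g e) \<in> Y) \<or> (fst (g e) \<in> Y \<and> snd (g e) \<in> X)})"
proof -
  have c: "int (card {e\<in>E. (fst (g e) \<in> X \<and> snd (g e) \<in> Y) \<or> (fst (g e) \<in> Y \<and> snd (g e) \<in> X)})
    = (\<Sum>e\<in>E. of_bool ((fst (g e) \<in> X \<and> snd (g e) \<in> Y) \<or> (fst (g e) \<in> Y \<and> snd (g e) \<in> X)))"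
    using assms(1) by (subst sum_of_bool_eq) (auto simp: Int_def)
  show ?thesis
    unfolding c cut_sum[OF assms(1)] sum.distrib[symmetric] sum_distrib_left sum_subtractf[symmetric]
    using assms(2) by (intro sum.cong) auto
qed

lemma cut_pair:
  assumes "finite E" "x \<noteq> y"
  shows "cut E g {x, y} = cut E g {x} + cut E g {y} - 2 * int (card (between E g x y))"
proof -
  have "{e\<in>E. (fst (g e) \<in> {x} \<and> snd (g e) \<in> {y}) \<or> (fst (g e) \<in> {y} \<and> snd (g e) \<in> {x})}
      = between E g x y"
    by (auto simp: between_def prod_eq_iff)
  moreover have "{x} \<union> {y} = {x, y}" by auto
  ultimately show ?thesis using cut_Un[OF assms(1), of "{x}" "{y}" g] assms(2) by simp
qed

section \<open>Contracting a vertex set\<close>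

text \<open>Vertex type and edge set stay the same: \<open>w\<close> stands for the merged vertex
  when it lies in \<open>S\<close>, and edges inside \<open>S\<close> become loops, invisible to
  \<open>cut\<close> and \<open>outflow\<close>.\<close>

definition contract :: "'v set \<Rightarrow> 'v \<Rightarrow> ('e \<Rightarrow> 'v \<times> 'v) \<Rightarrow> 'e \<Rightarrow> 'v \<times> 'v" where
  "contract S w g e = map_prod (\<lambda>v. if v \<in> S then w else v) (\<lambda>v. if v \<in> S then w else v) (g e)"

lemma cut_contract_point:
  assumes "w \<in> S"
  shows "cut E (contract S w g) X = cut E g (if w \<in> X then X \<union> S else X - S)"
proof -
  have "edge_cut E (contract S w g) X = edge_cut E g (if w \<in> X then X \<union> S else X - S)"
    using assms by (auto simp: edge_cut_def contract_def)
  then show ?thesis by (simp add: cut_def)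
qed

lemma outflow_contract_point:
  assumes "w \<in> S"
  shows "outflow E (contract S w g) s X = outflow E g s (if w \<in> X then X \<union> S else X - S)"
  unfolding outflow_def using assms by (intro sum.cong) (auto simp: contract_def)

section \<open>Adjusting parallel edges\<close>

lemma sign_choice:
  assumes "finite M" "\<bar>j\<bar> \<le> int (card M)" "even (j - int (card M))"
  shows "\<exists>s. signs M s \<and> sum s M = j"
  using assms
proof (induction M arbitrary: j rule: finite_induct)
  case empty
  then show ?case by (auto simp: signs_def)
next
  case (insert e M)
  define a :: int where "a = (if j > 0 then 1 else -1)"
  have "\<bar>j - a\<bar> \<le> int (card M)" "even ((j - a) - int (card M))"
    using insert.prems insert.hyps unfolding a_def by (simp_all, presburger+)
  from insert.IH[OF this] obtain s where s: "signs M s" "sum s M = j - a" by blast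
  have "signs (insert e M) (s(e := a))" using s(1) by (auto simp: signs_def a_def)
  moreover have "sum (s(e := a)) M = sum s M" using insert.hyps by (intro sum.cong) auto
  then have "sum (s(e := a)) (insert e M) = j" using s(2) insert.hyps by simp
  ultimately show ?case by blast
qed

text \<open>Reversing one edge between \<open>x\<close> and \<open>y\<close> changes the outflow of
  \<open>x\<close> by 2, so the reachable values are those of one parity in an interval centred at
  what the other edges contribute.\<close>

lemma adjust_parallel:
  assumes fin: "finite E" and xy: "x \<noteq> y" and s: "signs E s"
    and j: "\<bar>j - outflow (E - between E g x y) g s {x}\<bar> \<le> int (card (between E g x y))"
    and ev: "even (j - cut E g {x})"
  shows "\<exists>s'. signs E s' \<and> (\<forall>e\<in>E - between E g x y. s' e = s e) \<and> outflow E g s' {x} = j"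
proof -
  let ?M = "between E g x y"
  have ME: "?M \<subseteq> E" and fM: "finite ?M" using fin by (auto simp: between_def)
  have split: "outflow E g r {x} = outflow (E - ?M) g r {x} + outflow ?M g r {x}" for r
    unfolding outflow_def using sum.subset_diff[OF ME fin] by blast
  have "even (outflow (E - ?M) g s {x} - cut (E - ?M) g {x})"
    using s fin by (intro outflow_even) (auto simp: signs_def)
  moreover have "cut E g {x} = cut (E - ?M) g {x} + cut ?M g {x}"
    unfolding cut_sum[OF fin] cut_sum[OF finite_Diff[OF fin]] cut_sum[OF fM]
    using sum.subset_diff[OF ME fin] by blast
  moreover have "edge_cut ?M g {x} = ?M" using xy by (auto simp: edge_cut_def between_def prod_eq_iff)
  then have "cut ?M g {x} = int (card ?M)" by (simp add: cut_def)
  ultimately have "even ((j - outflow (E - ?M) g s {x}) - int (card ?M))"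
    using ev by presburger
  from sign_choice[OF fM j this] obtain c where
    c: "signs ?M c" "sum c ?M = j - outflow (E - ?M) g s {x}" by blast
  \<comment> \<open>\<open>c\<close> counts flow out of \<open>x\<close>; its sign relative to
    \<open>g\<close> depends on which end is listed first.\<close>
  define s' where "s' e = (if e \<in> ?M then (if fst (g e) = x then c e else - c e) else s e)" for e
  have "outflow ?M g s' {x} = sum c ?M"
    unfolding outflow_def using xy by (intro sum.cong) (auto simp: s'_def between_def prod_eq_iff)
  moreover have "outflow (E - ?M) g s' {x} = outflow (E - ?M) g s {x}"
    by (intro outflow_cong) (auto simp: s'_def)
  ultimately have "outflow E g s' {x} = j" using split c(2) by simp
  moreover have "signs E s'" using s c(1) by (auto simp: signs_def s'_def)
  ultimately show ?thesis by (intro exI[of _ s']) (auto simp: s'_def)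
qed

section \<open>Extending partial orientations modulo K\<close>

text \<open>\<open>U\<close> collects the exceptional vertices, shifted or being dissolved. Inside
  \<open>U\<close> the sum itself counts and not its residue, because a shifted target is a
  particular representative that may lie outside [-K, K].\<close>

definition demand :: "int \<Rightarrow> 'v set \<Rightarrow> ('v \<Rightarrow> int) \<Rightarrow> 'v set \<Rightarrow> int" where
  "demand K U t S = (if S \<subseteq> U then 3 * K - 5 + \<bar>sum t S\<bar> else 5 * K - 7 + circ_abs K (sum t S))"

text \<open>If the union is not inside \<open>U\<close>, neither is one of the parts; that part
  supplies the larger constant and the other still gives 3K - 5. The surplus 3K - 5 is what forces
  connectedness and heavily joined pairs.\<close>

lemma demand_superadd:
  assumes "K \<ge> 3" "finite S1" "finite S2" "S1 \<inter> S2 = {}"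
  shows "demand K U t (S1 \<union> S2) + (3 * K - 5) \<le> demand K U t S1 + demand K U t S2"
proof -
  have s: "sum t (S1 \<union> S2) = sum t S1 + sum t S2" using assms by (simp add: sum.union_disjoint)
  have n: "circ_abs K (sum t S1 + sum t S2) \<le> circ_abs K (sum t S1) + circ_abs K (sum t S2)"
    using assms by (intro circ_abs_triangle) auto
  have a: "circ_abs K (sum t S1) \<le> \<bar>sum t S1\<bar>" "circ_abs K (sum t S2) \<le> \<bar>sum t S2\<bar>"
    using assms by (auto intro!: circ_abs_le_abs)
  show ?thesis unfolding demand_def s using n a assms(1) by auto
qed

lemma demand_even:
  assumes "K \<ge> 3" "odd K"
  shows "even (demand K U t S - sum t S)"
proof -
  have "even (circ_abs K (sum t S) - sum t S)" using assms by (intro circ_abs_even) auto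
  moreover have "even (3 * K - 5)" "even (5 * K - 7)" using assms(2) by auto
  ultimately show ?thesis unfolding demand_def by (simp split: if_split; presburger)
qed

text \<open>An edge with an end outside W is already oriented, by P, so the complement of W acts as one
  vertex with pre-oriented edges. Y contains at most one vertex, which is being dissolved by lifting and has no
  degree bound of its own. L consists of the vertices whose target has been shifted by 2K; they
  satisfy only the smaller bound in the first case of \<open>demand\<close>.\<close>

definition admissible :: "int \<Rightarrow> 'e set \<Rightarrow> ('e \<Rightarrow> 'v \<times> 'v) \<Rightarrow> ('e \<Rightarrow> int) \<Rightarrow>
    'v set \<Rightarrow> 'v set \<Rightarrow> 'v set \<Rightarrow> ('v \<Rightarrow> int) \<Rightarrow> bool" where
  "admissible K E g P W Y L t \<longleftrightarrow>
     finite E \<and> signs E P \<and> finite W \<and> Y \<subseteq> W \<and> L \<subseteq> W - Y \<and> W - Y \<noteq> {} \<and>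
     (\<forall>y\<in>Y. \<forall>y'\<in>Y. y = y') \<and> (\<forall>y\<in>Y. t y = 0) \<and>
     card L \<le> 2 \<and> (\<forall>u\<in>L. \<forall>v\<in>L. u \<noteq> v \<longrightarrow> t u * t v \<le> 0) \<and>
     (\<forall>x\<in>L. \<bar>t x\<bar> \<le> 2 * K - 1) \<and> (\<forall>x\<in>W - Y - L. \<bar>t x\<bar> \<le> K) \<and>
     (\<forall>x\<in>W. even (t x - cut E g {x})) \<and>
     2 * K dvd outflow E g P W - sum t W \<and>
     (\<forall>S. S \<subseteq> W \<longrightarrow> \<not> S \<subseteq> Y \<longrightarrow> \<not> W - Y \<subseteq> S \<longrightarrow> demand K (L \<union> Y) t S \<le> cut E g S) \<and>
     cut E g W \<le> demand K (L \<union> Y) t W \<and> cut E g W \<le> cut E g (W - Y)"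

definition solvable :: "int \<Rightarrow> 'e set \<Rightarrow> ('e \<Rightarrow> 'v \<times> 'v) \<Rightarrow> ('e \<Rightarrow> int) \<Rightarrow>
    'v set \<Rightarrow> ('v \<Rightarrow> int) \<Rightarrow> bool" where
  "solvable K E g P W t \<longleftrightarrow> (\<exists>s. signs E s \<and>
     (\<forall>e\<in>E. \<not> (fst (g e) \<in> W \<and> snd (g e) \<in> W) \<longrightarrow> s e = P e) \<and>
     (\<forall>x\<in>W. 2 * K dvd outflow E g s {x} - t x))"

lemma admissibleD:
  assumes "admissible K E g P W Y L t"
  shows "finite E" "signs E P" "finite W" "Y \<subseteq> W" "L \<subseteq> W - Y" "W - Y \<noteq> {}"
    "\<And>y y'. y \<in> Y \<Longrightarrow> y' \<in> Y \<Longrightarrow> y = y'" "\<And>y. y \<in> Y \<Longrightarrow> t y = 0"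
    "card L \<le> 2" "\<And>u v. u \<in> L \<Longrightarrow> v \<in> L \<Longrightarrow> u \<noteq> v \<Longrightarrow> t u * t v \<le> 0"
    "\<And>x. x \<in> L \<Longrightarrow> \<bar>t x\<bar> \<le> 2 * K - 1" "\<And>x. x \<in> W - Y - L \<Longrightarrow> \<bar>t x\<bar> \<le> K"
    "\<And>x. x \<in> W \<Longrightarrow> even (t x - cut E g {x})"
    "2 * K dvd outflow E g P W - sum t W"
    "\<And>S. S \<subseteq> W \<Longrightarrow> \<not> S \<subseteq> Y \<Longrightarrow> \<not> W - Y \<subseteq> S \<Longrightarrow> demand K (L \<union> Y) t S \<le> cut E g S"
    "cut E g W \<le> demand K (L \<union> Y) t W" "cut E g W \<le> cut E g (W - Y)"
  using assms unfolding admissible_def by simp_all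

lemma admissible_finite:
  assumes "admissible K E g P W Y L t"
  shows "finite L" "finite Y"
  using admissibleD(3-5)[OF assms] by (auto intro: finite_subset)

lemma sum_zero:
  assumes "admissible K E g P W Y L t" "S \<subseteq> W"
  shows "sum t (S - Y) = sum t S"
  using admissibleD[OF assms(1)] assms(2) by (intro sum.mono_neutral_left) (auto intro: finite_subset)

text \<open>At most two terms are nonzero, and two such terms have opposite signs, so they cancel
  instead of adding up. This is the purpose of the sign condition on \<open>L\<close>.\<close>

lemma low_sum_gen:
  fixes K :: int and t :: "'v \<Rightarrow> int"
  assumes K: "K \<ge> 3" and S: "S \<subseteq> L \<union> Y" and f: "finite L" "finite Y"
    and L: "card L \<le> 2" "\<And>u v. u \<in> L \<Longrightarrow> v \<in> L \<Longrightarrow> u \<noteq> v \<Longrightarrow> t u * t v \<le> 0"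
      "\<And>x. x \<in> L \<Longrightarrow> \<bar>t x\<bar> \<le> 2 * K - 1"
    and Y: "\<And>y. y \<in> Y \<Longrightarrow> t y = 0"
  shows "\<bar>sum t S\<bar> \<le> 2 * K - 1"
proof -
  have SL: "S - Y \<subseteq> L" using S by auto
  have "card (S - Y) \<le> 2" using card_mono[OF f(1) SL] L(1) by simp
  then consider "card (S - Y) = 0" | "card (S - Y) = 1" | "card (S - Y) = 2" by linarith
  then have "\<bar>sum t (S - Y)\<bar> \<le> 2 * K - 1"
  proof cases
    case 1
    then have "S - Y = {}" using finite_subset[OF SL f(1)] by (simp only: card_eq_0_iff) auto
    then have "sum t (S - Y) = 0" by (simp only: sum.empty)
    then show ?thesis using K by simp
  next
    case 2
    then obtain x where "S - Y = {x}" by (auto simp: card_1_singleton_iff)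
    then show ?thesis using L(3)[of x] SL by simp
  next
    case 3
    then obtain x y where xy: "S - Y = {x, y}" "x \<noteq> y" by (auto simp: card_2_iff)
    then have "t x * t y \<le> 0" using L(2) SL by auto
    then have "(0 \<le> t x \<and> t y \<le> 0) \<or> (t x \<le> 0 \<and> 0 \<le> t y)" by (auto simp: mult_le_0_iff)
    moreover have "\<bar>t x\<bar> \<le> 2 * K - 1" "\<bar>t y\<bar> \<le> 2 * K - 1" using L(3) xy SL by auto
    ultimately show ?thesis using xy by auto
  qed
  moreover have "sum t (S - Y) = sum t S"
    using finite_subset[OF S] f Y by (intro sum.mono_neutral_left) auto
  ultimately show ?thesis by simp
qed

lemma low_sum:
  assumes i: "admissible K E g P W Y L t" and K: "K \<ge> 3" and S: "S \<subseteq> L \<union> Y"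
  shows "\<bar>sum t S\<bar> \<le> 2 * K - 1"
  using admissibleD(8-11)[OF i] admissible_finite[OF i] by (intro low_sum_gen[OF K S]) auto

lemma admissible_cut_even:
  assumes i: "admissible K E g P W Y L t" and S: "S \<subseteq> W"
  shows "even (cut E g S - sum t S)"
proof -
  note D = admissibleD[OF i]
  have fS: "finite S" using D(3) S finite_subset by auto
  have "even (\<Sum>x\<in>S. t x - cut E g {x})" using D(13) S by (intro dvd_sum) auto
  then show ?thesis using cut_even[OF D(1) fS, of g] by (simp add: sum_subtractf)
qed

text \<open>Both sides have the parity of \<open>sum t S\<close>. The gain of 2 pays for a lifting,
  which takes two edges from a cut, and for directing an edge, which takes one and may raise the
  demand by one.\<close>

lemma admissible_slack:
  assumes i: "admissible K E g P W Y L t" and K: "K \<ge> 3" "odd K" and S: "S \<subseteq> W"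
    and r: "demand K (L \<union> Y) t S < cut E g S"
  shows "demand K (L \<union> Y) t S + 2 \<le> cut E g S"
  using admissible_cut_even[OF i S] demand_even[OF K, of "L \<union> Y" t S] r by presburger

section \<open>Contraction and restriction of admissible instances\<close>

text \<open>A merger of exceptional vertices keeps the exact sum, since \<open>demand\<close>
  measures that sum. Otherwise only the residue counts, and a representative in [-K, K] restores the
  bound for ordinary targets.\<close>

definition contract_target :: "int \<Rightarrow> 'v set \<Rightarrow> 'v set \<Rightarrow> 'v \<Rightarrow> ('v \<Rightarrow> int) \<Rightarrow> 'v \<Rightarrow> int" where
  "contract_target K U S w t = t(w := if S \<subseteq> U then sum t S
     else (SOME r. 2 * K dvd r - sum t S \<and> \<bar>r\<bar> = circ_abs K (sum t S) \<and> \<bar>r\<bar> \<le> K))"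

lemma contract_target:
  assumes "K \<ge> 3"
  shows "v \<noteq> w \<Longrightarrow> contract_target K U S w t v = t v"
    "S \<subseteq> U \<Longrightarrow> contract_target K U S w t w = sum t S"
    "2 * K dvd contract_target K U S w t w - sum t S"
    "\<not> S \<subseteq> U \<Longrightarrow> \<bar>contract_target K U S w t w\<bar> \<le> K"
proof -
  have "\<exists>r. 2 * K dvd r - sum t S \<and> \<bar>r\<bar> = circ_abs K (sum t S) \<and> \<bar>r\<bar> \<le> K"
    using assms by (intro circ_abs_rep) auto
  from someI_ex[OF this] show "2 * K dvd contract_target K U S w t w - sum t S"
    "\<not> S \<subseteq> U \<Longrightarrow> \<bar>contract_target K U S w t w\<bar> \<le> K" by (auto simp: contract_target_def)
qed (auto simp: contract_target_def)

text \<open>A set of contracted vertices has a preimage (\<open>?pre\<close>) with the same cut and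
  the same demand, so the new conditions are a selection of the old ones. The merged vertex is
  exceptional exactly if all of \<open>S\<close> was.\<close>

lemma admissible_contract:
  assumes i: "admissible K E g P W Y L t" and K: "K \<ge> 3" and S: "S \<subseteq> W" and w: "w \<in> S - Y"
  shows "admissible K E (contract S w g) P (W - S \<union> {w}) (Y - S)
    (if S \<subseteq> L \<union> Y then L - S \<union> {w} else L - S) (contract_target K (L \<union> Y) S w t)"
    (is "admissible K E ?g P ?W ?Y ?L ?t")
proof -
  note D = admissibleD[OF i]
  note T = contract_target[OF K, where U = "L \<union> Y" and S = S and w = w and t = t]
  have wS: "w \<in> S" and wY: "w \<notin> Y" and wW: "w \<in> W" using w S by auto
  have fS: "finite S" using D(3) S finite_subset by auto
  let ?pre = "\<lambda>X. if w \<in> X then X \<union> S else X"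
  have cutX: "cut E ?g X = cut E g (?pre X)" "outflow E ?g s X = outflow E g s (?pre X)"
    if "X \<subseteq> ?W" for X s
  proof -
    have "X - S = X" if "w \<notin> X" using that \<open>X \<subseteq> ?W\<close> by auto
    then show "cut E ?g X = cut E g (?pre X)" "outflow E ?g s X = outflow E g s (?pre X)"
      unfolding cut_contract_point[OF wS] outflow_contract_point[OF wS] by auto
  qed
  have sumX: "2 * K dvd sum ?t X - sum t (?pre X)"
      "S \<subseteq> L \<union> Y \<or> w \<notin> X \<Longrightarrow> sum ?t X = sum t (?pre X)" if X: "X \<subseteq> ?W" for X
  proof -
    have fX: "finite X" using X D(3) by (auto intro: finite_subset)
    have nw: "sum ?t X = sum t X" if "w \<notin> X" using that by (intro sum.cong refl T(1)) auto
    have yw: "sum ?t X = ?t w + sum t (X - {w})" "sum t (X \<union> S) = sum t S + sum t (X - {w})"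
      if "w \<in> X"
    proof -
      have "sum ?t (X - {w}) = sum t (X - {w})" using T(1) by (intro sum.cong) auto
      then show "sum ?t X = ?t w + sum t (X - {w})" using sum.remove[OF fX that, of ?t] by simp
      have "X \<union> S = S \<union> (X - {w})" "S \<inter> (X - {w}) = {}" using X that wS by auto
      then show "sum t (X \<union> S) = sum t S + sum t (X - {w})"
        using fX fS by (simp add: sum.union_disjoint)
    qed
    show "2 * K dvd sum ?t X - sum t (?pre X)" using nw yw T(3) by (cases "w \<in> X") auto
    show "sum ?t X = sum t (?pre X)" if "S \<subseteq> L \<union> Y \<or> w \<notin> X"
      using nw yw T(2) that by (cases "w \<in> X") auto
  qed
  have sub: "X \<subseteq> ?L \<union> ?Y \<longleftrightarrow> ?pre X \<subseteq> L \<union> Y" if "X \<subseteq> ?W" for X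
    using that wS wY by (auto split: if_splits)
  have reqX: "demand K (?L \<union> ?Y) ?t X = demand K (L \<union> Y) t (?pre X)" if X: "X \<subseteq> ?W" for X
  proof (cases "?pre X \<subseteq> L \<union> Y")
    case True
    then have "S \<subseteq> L \<union> Y \<or> w \<notin> X" by (auto split: if_splits)
    then show ?thesis using True sub[OF X] sumX(2)[OF X] by (simp add: demand_def)
  next
    case False
    then show ?thesis using sub[OF X] circ_abs_cong[OF sumX(1)[OF X]] by (simp add: demand_def)
  qed
  have Lw: "w \<in> L" if "S \<subseteq> L \<union> Y" using that w by auto
  have LL: "?L \<subseteq> L" using Lw by auto
  have fL: "finite L" using admissible_finite[OF i] by simp
  show ?thesis
    unfolding admissible_def
  proof (intro conjI)
    show "finite E" "signs E P" "finite ?W" using D by auto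
    show "?Y \<subseteq> ?W" "?L \<subseteq> ?W - ?Y" "?W - ?Y \<noteq> {}" using D(4,5) wS by auto
    show "\<forall>y\<in>?Y. \<forall>y'\<in>?Y. y = y'" using D(7) by auto
    show "\<forall>y\<in>?Y. ?t y = 0" using D(8) T(1) wS by (metis DiffE)
    show "card ?L \<le> 2" using card_mono[OF fL LL] D(9) by simp
    show "\<forall>u\<in>?L. \<forall>v\<in>?L. u \<noteq> v \<longrightarrow> ?t u * ?t v \<le> 0"
    proof (intro ballI impI)
      fix u v assume u: "u \<in> ?L" and v: "v \<in> ?L" and uv: "u \<noteq> v"
      have uvL: "u \<in> L" "v \<in> L" using u v LL by auto
      \<comment> \<open>\<open>L\<close> has no third element. So if \<open>w\<close> is
        \<open>u\<close> or \<open>v\<close>, then \<open>S\<close> meets \<open>L\<close> only in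
        \<open>w\<close>, and besides \<open>w\<close> it contains only vertices of
        \<open>Y\<close>, whose target is 0.\<close>
      have Luv: "L = {u, v}"
        using card_seteq[of L "{u, v}"] uvL uv D(9) fL by auto
      have tw: "?t w = t w" if "w \<in> {u, v}"
      proof -
        have SU: "S \<subseteq> L \<union> Y" using u v that wS by (auto split: if_splits)
        have "S - Y = {w}" using u v uv that SU Luv w by (auto split: if_splits)
        then have "sum t S = t w" using sum_zero[OF i S] by simp
        then show ?thesis using T(2)[OF SU] by simp
      qed
      have "?t u = t u" "?t v = t v" using tw T(1) by (metis insertCI)+
      then show "?t u * ?t v \<le> 0" using D(10) uvL uv by simp
    qed
    show "\<forall>x\<in>?L. \<bar>?t x\<bar> \<le> 2 * K - 1"
    proof
      fix x assume x: "x \<in> ?L"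
      show "\<bar>?t x\<bar> \<le> 2 * K - 1"
      proof (cases "x = w")
        case True
        then have "S \<subseteq> L \<union> Y" using x wS by (auto split: if_splits)
        then show ?thesis using low_sum[OF i K] T(2) True by simp
      next
        case False
        then show ?thesis using x LL D(11) T(1) by auto
      qed
    qed
    show "\<forall>x\<in>?W - ?Y - ?L. \<bar>?t x\<bar> \<le> K"
    proof
      fix x assume x: "x \<in> ?W - ?Y - ?L"
      show "\<bar>?t x\<bar> \<le> K"
      proof (cases "x = w")
        case True
        then have "\<not> S \<subseteq> L \<union> Y" using x by auto
        then show ?thesis using T(4) True by simp
      next
        case False
        then have "x \<in> W - Y - L" using x by (auto split: if_splits)
        then show ?thesis using D(12) T(1)[OF False] by simp
      qed
    qed
    show "\<forall>x\<in>?W. even (?t x - cut E ?g {x})"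
    proof
      fix x assume x: "x \<in> ?W"
      have c: "cut E ?g {x} = cut E g (?pre {x})" using cutX[of "{x}"] x by simp
      have "?pre {x} \<subseteq> W" using x S wW by auto
      then have e1: "even (cut E ?g {x} - sum t (?pre {x}))" unfolding c by (rule admissible_cut_even[OF i])
      have "2 * K dvd ?t x - sum t (?pre {x})" using sumX(1)[of "{x}"] x by simp
      then have e2: "even (?t x - sum t (?pre {x}))" by (metis dvd_mult_left)
      have "even ((?t x - sum t (?pre {x})) - (cut E ?g {x} - sum t (?pre {x})))"
        by (rule dvd_diff[OF e2 e1])
      then show "even (?t x - cut E ?g {x})" by (simp only: diff_diff_eq2 diff_add_cancel)
    qed
    have pW: "?pre ?W = W" using S wS by auto
    show "2 * K dvd outflow E ?g P ?W - sum ?t ?W"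
    proof -
      have "outflow E ?g P ?W = outflow E g P W" using cutX(2)[of ?W P] pW by simp
      moreover have "2 * K dvd sum ?t ?W - sum t W" using sumX(1)[of ?W] unfolding pW by blast
      then have "2 * K dvd (outflow E g P W - sum t W) - (sum ?t ?W - sum t W)"
        by (rule dvd_diff[OF D(14)])
      ultimately show ?thesis by (simp only: diff_diff_eq2 diff_add_cancel)
    qed
    show "\<forall>X. X \<subseteq> ?W \<longrightarrow> \<not> X \<subseteq> ?Y \<longrightarrow> \<not> ?W - ?Y \<subseteq> X \<longrightarrow> demand K (?L \<union> ?Y) ?t X \<le> cut E ?g X"
    proof (intro allI impI)
      fix X assume X: "X \<subseteq> ?W" "\<not> X \<subseteq> ?Y" "\<not> ?W - ?Y \<subseteq> X"
      have "?pre X \<subseteq> W" using X(1) S wW by auto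
      moreover have "\<not> ?pre X \<subseteq> Y" using X(1,2) w by auto
      moreover have "\<not> W - Y \<subseteq> ?pre X" using X(1,3) w S by auto
      ultimately show "demand K (?L \<union> ?Y) ?t X \<le> cut E ?g X"
        using D(15) cutX(1)[OF X(1)] reqX[OF X(1)] by simp
    qed
    show "cut E ?g ?W \<le> demand K (?L \<union> ?Y) ?t ?W"
      using D(16) cutX(1)[of ?W] reqX[of ?W] pW by simp
    show "cut E ?g ?W \<le> cut E ?g (?W - ?Y)"
    proof (cases "Y \<subseteq> S")
      case True
      then show ?thesis by (simp add: Diff_eq_empty_iff[THEN iffD2])
    next
      case False
      then have "Y \<inter> S = {}" using D(7) by auto
      then have "?pre (?W - ?Y) = W - Y" using S wS by auto
      then show ?thesis using cutX(1)[of ?W] cutX(1)[of "?W - ?Y"] pW D(17) by auto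
    qed
  qed
qed

text \<open>The inside of \<open>S\<close> becomes the new instance, with the edges leaving
  \<open>S\<close> fixed by \<open>s\<close>; tightness is precisely the upper bound needed on their
  number.\<close>

lemma admissible_restrict:
  assumes i: "admissible K E g P W Y L t" and K: "K \<ge> 3" and S: "S \<subseteq> W" "\<not> S \<subseteq> Y" "\<not> W - Y \<subseteq> S"
    and tight: "cut E g S \<le> demand K (L \<union> Y) t S"
    and s: "signs E s" "2 * K dvd outflow E g s S - sum t S"
  shows "admissible K E g s S (Y \<inter> S) (L \<inter> S) t"
proof -
  note D = admissibleD[OF i]
  have demand': "demand K (L \<inter> S \<union> Y \<inter> S) t X = demand K (L \<union> Y) t X" if "X \<subseteq> S" for X
  proof -
    have "X \<subseteq> L \<inter> S \<union> Y \<inter> S \<longleftrightarrow> X \<subseteq> L \<union> Y" using that by auto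
    then show ?thesis by (simp add: demand_def)
  qed
  have fS: "finite S" using D(3) S finite_subset by auto
  have fL: "finite L" using admissible_finite[OF i] by simp
  show ?thesis
    unfolding admissible_def
  proof (intro conjI)
    show "finite E" "signs E s" "finite S" using D s fS by auto
    show "Y \<inter> S \<subseteq> S" by auto
    show "L \<inter> S \<subseteq> S - Y \<inter> S" "S - Y \<inter> S \<noteq> {}" using D(5) S by auto
    show "\<forall>y\<in>Y \<inter> S. \<forall>y'\<in>Y \<inter> S. y = y'" "\<forall>y\<in>Y \<inter> S. t y = 0" using D(7,8) by auto
    show "card (L \<inter> S) \<le> 2" using card_mono[OF fL, of "L \<inter> S"] D(9) by auto
    show "\<forall>u\<in>L \<inter> S. \<forall>v\<in>L \<inter> S. u \<noteq> v \<longrightarrow> t u * t v \<le> 0" using D(10) by blast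
    show "\<forall>x\<in>L \<inter> S. \<bar>t x\<bar> \<le> 2 * K - 1" using D(11) by blast
    show "\<forall>x\<in>S - Y \<inter> S - L \<inter> S. \<bar>t x\<bar> \<le> K" using D(12) S(1) by blast
    show "\<forall>x\<in>S. even (t x - cut E g {x})" using D(13) S(1) by blast
    show "2 * K dvd outflow E g s S - sum t S" by fact
    show "\<forall>X. X \<subseteq> S \<longrightarrow> \<not> X \<subseteq> Y \<inter> S \<longrightarrow> \<not> S - Y \<inter> S \<subseteq> X \<longrightarrow>
        demand K (L \<inter> S \<union> Y \<inter> S) t X \<le> cut E g X"
    proof (intro allI impI)
      fix X assume X: "X \<subseteq> S" "\<not> X \<subseteq> Y \<inter> S" "\<not> S - Y \<inter> S \<subseteq> X"
      have "X \<subseteq> W" "\<not> X \<subseteq> Y" "\<not> W - Y \<subseteq> X" using X S by auto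
      then show "demand K (L \<inter> S \<union> Y \<inter> S) t X \<le> cut E g X" using D(15) demand'[OF X(1)] by simp
    qed
    show "cut E g S \<le> demand K (L \<inter> S \<union> Y \<inter> S) t S" using tight demand' by simp
    \<comment> \<open>Removing target 0 vertices of \<open>Y\<close> does not change the demand,
      which by tightness lies between the two cuts to be compared.\<close>
    have "demand K (L \<union> Y) t (S - Y) = demand K (L \<union> Y) t S"
      using sum_zero[OF i S(1)] by (auto simp: demand_def)
    moreover have "demand K (L \<union> Y) t (S - Y) \<le> cut E g (S - Y)" using S by (intro D(15)) auto
    ultimately show "cut E g S \<le> cut E g (S - Y \<inter> S)"
      using tight by (simp add: Diff_Int)
  qed
qed

text \<open>The contracted instance orients all edges leaving \<open>S\<close>, with net outflow
  congruent to \<open>sum t S\<close>. That orientation is the fixed part for the instance inside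
  \<open>S\<close>, which then changes only edges with both ends in \<open>S\<close>.\<close>

lemma solvable_glue:
  assumes i: "admissible K E g P W Y L t" and K: "K \<ge> 3" and S: "S \<subseteq> W" "w \<in> S - Y" "\<not> W - Y \<subseteq> S"
    and tight: "cut E g S \<le> demand K (L \<union> Y) t S"
    and con: "solvable K E (contract S w g) P (W - S \<union> {w}) (contract_target K (L \<union> Y) S w t)"
    and res: "\<And>s. admissible K E g s S (Y \<inter> S) (L \<inter> S) t \<Longrightarrow> solvable K E g s S t"
  shows "solvable K E g P W t"
proof -
  note D = admissibleD[OF i]
  note T = contract_target[OF K, where U = "L \<union> Y" and S = S and w = w and t = t]
  have wS: "w \<in> S" using S by auto
  obtain s where s: "signs E s"
    "\<And>e. e \<in> E \<Longrightarrow> \<not> (fst (contract S w g e) \<in> W - S \<union> {w} \<and> snd (contract S w g e) \<in> W - S \<union> {w}) \<Longrightarrow> s e = P e"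
    "\<And>x. x \<in> W - S \<union> {w} \<Longrightarrow>
      2 * K dvd outflow E (contract S w g) s {x} - contract_target K (L \<union> Y) S w t x"
    using con unfolding solvable_def by blast
  have "2 * K dvd outflow E g s S - contract_target K (L \<union> Y) S w t w"
    using s(3)[of w] wS by (simp add: outflow_contract_point insert_absorb)
  from dvd_add[OF this T(3)] have "2 * K dvd outflow E g s S - sum t S" by simp
  then have "admissible K E g s S (Y \<inter> S) (L \<inter> S) t" using S by (intro admissible_restrict[OF i K S(1) _ _ tight s(1)]) auto
  from res[OF this] obtain r where r: "signs E r"
    "\<And>e. e \<in> E \<Longrightarrow> \<not> (fst (g e) \<in> S \<and> snd (g e) \<in> S) \<Longrightarrow> r e = s e"
    "\<And>x. x \<in> S \<Longrightarrow> 2 * K dvd outflow E g r {x} - t x"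
    unfolding solvable_def by blast
  show ?thesis
    unfolding solvable_def
  proof (intro exI[of _ r] conjI ballI impI)
    show "signs E r" by fact
  next
    fix e assume e: "e \<in> E" "\<not> (fst (g e) \<in> W \<and> snd (g e) \<in> W)"
    have "r e = s e" using r(2)[OF e(1)] e(2) S(1) by blast
    also have "s e = P e" using e S by (intro s(2)) (auto simp: contract_def)
    finally show "r e = P e" .
  next
    fix x assume x: "x \<in> W"
    show "2 * K dvd outflow E g r {x} - t x"
    proof (cases "x \<in> S")
      case False
      have "outflow E g r {x} = outflow E g s {x}" using False by (intro outflow_cong r(2)) auto
      also have "\<dots> = outflow E (contract S w g) s {x}"
      proof -
        have "w \<notin> {x}" "{x} - S = {x}" using False wS by auto
        then show ?thesis using outflow_contract_point[OF wS, of E g s "{x}"] by simp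
      qed
      finally have o: "outflow E g r {x} = outflow E (contract S w g) s {x}" .
      have "x \<noteq> w" using False wS by auto
      then show ?thesis using s(3)[of x] x False T(1)[of x] unfolding o by simp
    qed (rule r(3))
  qed
qed

section \<open>Merging a pair of vertices\<close>

text \<open>The edges between \<open>x\<close> and \<open>y\<close> are loops in the merged graph
  and can be chosen afterwards to give \<open>x\<close> the outflow \<open>j\<close>. The total over
  the pair is already right, so \<open>y\<close> comes out right as well.\<close>

lemma solvable_merge:
  assumes fin: "finite E" and W: "x \<in> W" "y \<in> W" "x \<noteq> y"
    and con: "solvable K E (contract {x, y} w g) P (W - {x, y} \<union> {w}) t'" and w: "w \<in> {x, y}"
    and t': "\<And>v. v \<in> W - {x, y} \<Longrightarrow> t' v = t v" "2 * K dvd t' w - (t x + t y)"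
    and ev: "even (t x - cut E g {x})"
    and j: "\<And>s. signs E s \<Longrightarrow>
      \<exists>j. 2 * K dvd j - t x \<and> \<bar>j - outflow (E - between E g x y) g s {x}\<bar> \<le> int (card (between E g x y))"
  shows "solvable K E g P W t"
proof -
  let ?M = "between E g x y"
  obtain s where s: "signs E s"
    "\<And>e. e \<in> E \<Longrightarrow> \<not> (fst (contract {x, y} w g e) \<in> W - {x, y} \<union> {w} \<and> snd (contract {x, y} w g e) \<in> W - {x, y} \<union> {w}) \<Longrightarrow> s e = P e"
    "\<And>v. v \<in> W - {x, y} \<union> {w} \<Longrightarrow> 2 * K dvd outflow E (contract {x, y} w g) s {v} - t' v"
    using con unfolding solvable_def by blast
  obtain j where j': "2 * K dvd j - t x" "\<bar>j - outflow (E - ?M) g s {x}\<bar> \<le> int (card ?M)"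
    using j[OF s(1)] by blast
  have "even (j - t x)" using j'(1) by (metis dvd_mult_left)
  then have "even (j - cut E g {x})" using ev by presburger
  from adjust_parallel[OF fin W(3) s(1) j'(2) this]
  obtain r where r: "signs E r" "\<And>e. e \<in> E - ?M \<Longrightarrow> r e = s e" "outflow E g r {x} = j" by blast
  have same: "outflow E g r X = outflow E g s X" if "x \<in> X \<longleftrightarrow> y \<in> X" for X
    using that by (intro outflow_cong r(2)) (auto simp: between_def)
  have "2 * K dvd outflow E g s {x, y} - t' w"
    using s(3)[of w] w by (auto simp: outflow_contract_point[of w] insert_commute)
  from dvd_add[OF this t'(2)] have xy: "2 * K dvd outflow E g s {x, y} - (t x + t y)"
    by (simp only: add_diff_eq diff_add_cancel)
  have rxy: "outflow E g s {x, y} = j + outflow E g r {y}"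
    using same[of "{x, y}"] outflow_singletons[of "{x, y}" E g r] W(3) r(3) by simp
  show ?thesis
    unfolding solvable_def
  proof (intro exI[of _ r] conjI ballI impI)
    show "signs E r" by fact
  next
    fix e assume e: "e \<in> E" "\<not> (fst (g e) \<in> W \<and> snd (g e) \<in> W)"
    have "r e = s e" using e W by (intro r(2)) (auto simp: between_def)
    also have "s e = P e" using e W w by (intro s(2)) (auto simp: contract_def)
    finally show "r e = P e" .
  next
    fix v assume v: "v \<in> W"
    consider "v = x" | "v = y" | "v \<in> W - {x, y}" using v by blast
    then show "2 * K dvd outflow E g r {v} - t v"
    proof cases
      case 1
      then show ?thesis using r(3) j'(1) by simp
    next
      case 2
      have "outflow E g r {y} - t y = (outflow E g s {x, y} - (t x + t y)) - (j - t x)"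
        using rxy by simp
      then have "2 * K dvd outflow E g r {y} - t y" using dvd_diff[OF xy j'(1)] by metis
      then show ?thesis using 2 by simp
    next
      case 3
      have "outflow E g r {v} = outflow E g s {v}" using 3 by (intro same) auto
      also have "\<dots> = outflow E (contract {x, y} w g) s {v}"
        using 3 w by (subst outflow_contract_point) auto
      finally show ?thesis using s(3)[of v] t'(1)[of v] 3 by simp
    qed
  qed
qed

text \<open>The interval holds m + 1 >= K numbers of the parity of \<open>a\<close>, and K
  consecutive ones meet every residue of that parity modulo 2K.\<close>

lemma fat_window:
  assumes K: "K \<ge> 3" and m: "m \<ge> K - 1" and ev: "even (a - c - m)"
  shows "\<exists>j::int. 2 * K dvd j - a \<and> \<bar>j - c\<bar> \<le> m"
proof -
  obtain r where r: "2 * K dvd r - (a - c)" "\<bar>r\<bar> = circ_abs K (a - c)" "\<bar>r\<bar> \<le> K"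
    using circ_abs_rep[of K "a - c"] K by auto
  have "even (\<bar>r\<bar> - (a - c))" using circ_abs_even[of K "a - c"] K r(2) by simp
  then have "even (\<bar>r\<bar> - m)" using ev by presburger
  \<comment> \<open>For m = K - 1 only |r| = K could exceed m, and it has the wrong parity.\<close>
  then have "\<bar>r\<bar> \<noteq> K \<or> m \<noteq> K - 1" by auto
  then have "\<bar>r\<bar> \<le> m" using r(3) m by linarith
  then show ?thesis using r(1) by (intro exI[of _ "r + c"]) (simp add: algebra_simps)
qed

lemma outflow_minus_parallel_even:
  assumes "finite E" "signs E s" "x \<noteq> y"
  shows "even (outflow (E - between E g x y) g s {x} - (cut E g {x} - int (card (between E g x y))))"
    "cut (E - between E g x y) g {x} = cut E g {x} - int (card (between E g x y))"
proof -
  let ?M = "between E g x y"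
  have ME: "?M \<subseteq> E" and fM: "finite ?M" using assms by (auto simp: between_def)
  have "edge_cut ?M g {x} = ?M" using assms by (auto simp: edge_cut_def between_def prod_eq_iff)
  then have "cut ?M g {x} = int (card ?M)" by (simp add: cut_def)
  moreover have "cut E g {x} = cut (E - ?M) g {x} + cut ?M g {x}"
    unfolding cut_sum[OF assms(1)] cut_sum[OF finite_Diff[OF assms(1)]] cut_sum[OF fM]
    using sum.subset_diff[OF ME assms(1)] by blast
  ultimately show c: "cut (E - between E g x y) g {x} = cut E g {x} - int (card (between E g x y))"
    by simp
  have "signs (E - ?M) s" using assms by (auto simp: signs_def)
  then show "even (outflow (E - between E g x y) g s {x} - (cut E g {x} - int (card (between E g x y))))"
    using outflow_even[of "E - ?M" s g "{x}"] assms c by simp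
qed

lemma solvable_fat:
  assumes i: "admissible K E g P W Y L t" and K: "K \<ge> 3" and W: "x \<in> W" "y \<in> W" "x \<noteq> y"
    and m: "int (card (between E g x y)) \<ge> K - 1"
    and con: "solvable K E (contract {x, y} x g) P (W - {x, y} \<union> {x}) (contract_target K (L \<union> Y) {x, y} x t)"
  shows "solvable K E g P W t"
proof (rule solvable_merge[OF admissibleD(1)[OF i] W con])
  note T = contract_target[OF K, where U = "L \<union> Y" and S = "{x, y}" and w = x and t = t]
  show "contract_target K (L \<union> Y) {x, y} x t v = t v" if "v \<in> W - {x, y}" for v
    using that by (intro T(1)) auto
  show "2 * K dvd contract_target K (L \<union> Y) {x, y} x t x - (t x + t y)" using T(3) W(3) by simp
  show ev: "even (t x - cut E g {x})" using admissibleD(13)[OF i W(1)] .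
  fix s :: "'a \<Rightarrow> int" assume s: "signs E s"
  show "\<exists>j. 2 * K dvd j - t x \<and> \<bar>j - outflow (E - between E g x y) g s {x}\<bar> \<le> int (card (between E g x y))"
    using outflow_minus_parallel_even(1)[OF admissibleD(1)[OF i] s W(3), of g] ev
    by (intro fat_window[OF K m]) presburger
qed simp

text \<open>At least half of the edges at \<open>y\<close> lead to \<open>x\<close>, so they can
  cancel whatever the others carry and give \<open>y\<close> outflow exactly 0, its target.\<close>

lemma solvable_absorb:
  assumes i: "admissible K E g P W Y L t" and K: "K \<ge> 3" and y: "y \<in> Y" and x: "x \<in> W - Y"
    and m: "2 * int (card (between E g y x)) \<ge> cut E g {y}"
    and con: "solvable K E (contract {y, x} x g) P (W - {y, x} \<union> {x}) (contract_target K (L \<union> Y) {y, x} x t)"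
  shows "solvable K E g P W t"
proof -
  note D = admissibleD[OF i]
  have W: "y \<in> W" "x \<in> W" "y \<noteq> x" using D(4) x y by auto
  note T = contract_target[OF K, where U = "L \<union> Y" and S = "{y, x}" and w = x and t = t]
  show ?thesis
  proof (rule solvable_merge[OF D(1) W con])
    show "contract_target K (L \<union> Y) {y, x} x t v = t v" if "v \<in> W - {y, x}" for v
      using that by (intro T(1)) auto
    show "2 * K dvd contract_target K (L \<union> Y) {y, x} x t x - (t y + t x)" using T(3) W(3) by simp
    show "even (t y - cut E g {y})" using D(13) W(1) .
    fix s :: "'a \<Rightarrow> int" assume s: "signs E s"
    have "\<bar>outflow (E - between E g y x) g s {y}\<bar> \<le> cut (E - between E g y x) g {y}"
      using D(1) s by (intro outflow_le_cut) (auto simp: signs_def)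
    then show "\<exists>j. 2 * K dvd j - t y \<and> \<bar>j - outflow (E - between E g y x) g s {y}\<bar> \<le> int (card (between E g y x))"
      using outflow_minus_parallel_even(2)[OF D(1) s W(3), of g] m D(8)[OF y]
      by (intro exI[of _ 0]) auto
  qed simp
qed

section \<open>Lifting a pair of edges\<close>

text \<open>The lifted edge from \<open>a\<close> to \<open>b\<close> reuses the name of one of the
  two old edges; the other is removed from the edge set separately.\<close>

definition lift_ends :: "'e \<Rightarrow> 'v \<Rightarrow> 'v \<Rightarrow> ('e \<Rightarrow> 'v \<times> 'v) \<Rightarrow> 'e \<Rightarrow> 'v \<times> 'v" where
  "lift_ends e a b g = g(e := (a, b))"

lemma edge_cut_point: "e \<in> edge_cut E g {y} \<longleftrightarrow> (\<exists>v. v \<noteq> y \<and> e \<in> between E g y v)"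
  by (cases "g e") (auto simp: edge_cut_def between_def)

text \<open>Undoes a lifting: the two old edges form a directed path through \<open>y\<close> in the
  direction of the lifted edge, so they contribute nothing to the outflow of
  \<open>y\<close>.\<close>

definition unlift :: "('e \<Rightarrow> 'v \<times> 'v) \<Rightarrow> 'e \<Rightarrow> 'e \<Rightarrow> 'v \<Rightarrow> ('e \<Rightarrow> int) \<Rightarrow> 'e \<Rightarrow> int" where
  "unlift g e1 e2 y s = s(e1 := if snd (g e1) = y then s e1 else - s e1,
     e2 := if fst (g e2) = y then s e1 else - s e1)"

context
  fixes E :: "'e set" and g :: "'e \<Rightarrow> 'v \<times> 'v" and e1 e2 :: 'e and y a b :: 'v
  assumes fin: "finite E" and e1: "e1 \<in> between E g y a" and e2: "e2 \<in> between E g y b"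
    and ab: "a \<noteq> b" "a \<noteq> y" "b \<noteq> y"
begin

lemma lift_ends_cases:
  "e1 \<in> E" "e2 \<in> E"
  "fst (g e1) = y \<and> snd (g e1) = a \<or> fst (g e1) = a \<and> snd (g e1) = y"
  "fst (g e2) = y \<and> snd (g e2) = b \<or> fst (g e2) = b \<and> snd (g e2) = y"
  using e1 e2 by (auto simp: between_def)

lemma lift_split: "e1 \<noteq> e2" "E = insert e1 (insert e2 (E - {e1, e2}))" "E - {e2} = insert e1 (E - {e1, e2})"
  using e1 e2 ab by (auto simp: between_def)

text \<open>If \<open>a\<close> and \<open>b\<close> are on different sides, the new edge replaces
  the one old edge that crossed. Edges are lost only when \<open>y\<close> is separated from
  both.\<close>

lemma cut_lift:
  "cut (E - {e2}) (lift_ends e1 a b g) S =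
     cut E g S - (if (a \<in> S \<longleftrightarrow> b \<in> S) \<and> (a \<in> S \<longleftrightarrow> y \<notin> S) then 2 else 0)"
proof -
  let ?c = "\<lambda>g e. of_bool ((fst (g e) \<in> S) \<noteq> (snd (g e) \<in> S)) :: int"
  have "cut E g S = ?c g e1 + ?c g e2 + sum (?c g) (E - {e1, e2})"
    unfolding cut_sum[OF fin] using lift_split(1) fin by (subst lift_split(2)) simp
  moreover have "cut (E - {e2}) (lift_ends e1 a b g) S
      = ?c (lift_ends e1 a b g) e1 + sum (?c (lift_ends e1 a b g)) (E - {e1, e2})"
    unfolding cut_sum[OF finite_Diff[OF fin]] using fin by (subst lift_split(3)) simp
  moreover have "sum (?c (lift_ends e1 a b g)) (E - {e1, e2}) = sum (?c g) (E - {e1, e2})"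
    by (intro sum.cong) (auto simp: lift_ends_def)
  moreover have "?c (lift_ends e1 a b g) e1 = ?c g e1 + ?c g e2 -
      (if (a \<in> S \<longleftrightarrow> b \<in> S) \<and> (a \<in> S \<longleftrightarrow> y \<notin> S) then 2 else 0)"
    using lift_ends_cases(3,4) by (elim disjE conjE) (simp_all add: lift_ends_def, blast+)
  ultimately show ?thesis by simp
qed

lemma outflow_unlift: "outflow E g (unlift g e1 e2 y s) S = outflow (E - {e2}) (lift_ends e1 a b g) s S"
proof -
  let ?c = "\<lambda>g s e. s e * (of_bool (fst (g e) \<in> S) - of_bool (snd (g e) \<in> S)) :: int"
  let ?u = "unlift g e1 e2 y s" and ?h = "lift_ends e1 a b g"
  have "outflow E g ?u S = ?c g ?u e1 + ?c g ?u e2 + sum (?c g ?u) (E - {e1, e2})"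
    unfolding outflow_def using lift_split(1) fin by (subst lift_split(2)) simp
  moreover have "outflow (E - {e2}) ?h s S = ?c ?h s e1 + sum (?c ?h s) (E - {e1, e2})"
    unfolding outflow_def using fin by (subst lift_split(3)) simp
  moreover have "sum (?c ?h s) (E - {e1, e2}) = sum (?c g ?u) (E - {e1, e2})"
    by (intro sum.cong) (auto simp: lift_ends_def unlift_def)
  moreover have "?c ?h s e1 = ?c g ?u e1 + ?c g ?u e2"
    using lift_ends_cases(3,4) ab lift_split(1)
    by (elim disjE conjE) (simp_all add: lift_ends_def unlift_def)
  ultimately show ?thesis by simp
qed

lemma signs_unlift: "signs (E - {e2}) s \<Longrightarrow> signs E (unlift g e1 e2 y s)"
  using lift_split e1 by (auto simp: signs_def unlift_def between_def)

text \<open>If \<open>b\<close> lies outside \<open>W\<close>, the lifted edge must be fixed too; it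
  inherits the direction in which \<open>e2\<close> was fixed.\<close>

definition lift_sign :: "'v set \<Rightarrow> ('e \<Rightarrow> int) \<Rightarrow> 'e \<Rightarrow> int" where
  "lift_sign W P = (if b \<in> W then P else P(e1 := if fst (g e2) = y then P e2 else - P e2))"

lemma signs_lift: "signs E P \<Longrightarrow> signs (E - {e2}) (lift_sign W P)"
  using e2 by (auto simp: signs_def lift_sign_def between_def)

lemma solvable_lift:
  assumes W: "y \<in> W" "a \<in> W"
    and s: "solvable K (E - {e2}) (lift_ends e1 a b g) (lift_sign W P) W t"
  shows "solvable K E g P W t"
proof -
  let ?h = "lift_ends e1 a b g"
  obtain s where s: "signs (E - {e2}) s"
    "\<And>e. e \<in> E - {e2} \<Longrightarrow> \<not> (fst (?h e) \<in> W \<and> snd (?h e) \<in> W) \<Longrightarrow> s e = lift_sign W P e"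
    "\<And>x. x \<in> W \<Longrightarrow> 2 * K dvd outflow (E - {e2}) ?h s {x} - t x"
    using s unfolding solvable_def by blast
  show ?thesis
    unfolding solvable_def
  proof (intro exI[of _ "unlift g e1 e2 y s"] conjI ballI impI)
    show "signs E (unlift g e1 e2 y s)" using signs_unlift s(1) .
    show "2 * K dvd outflow E g (unlift g e1 e2 y s) {x} - t x" if "x \<in> W" for x
      using s(3)[OF that] outflow_unlift by simp
    fix e assume e: "e \<in> E" "\<not> (fst (g e) \<in> W \<and> snd (g e) \<in> W)"
    have ne1: "e \<noteq> e1" using e W e1 by (auto simp: between_def)
    show "unlift g e1 e2 y s e = P e"
    proof (cases "e = e2")
      case True
      have b: "b \<notin> W" using e e2 W True by (auto simp: between_def)
      have "s e1 = lift_sign W P e1"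
        using b lift_split(1) e1 by (intro s(2)) (auto simp: lift_ends_def between_def)
      then show ?thesis using True b by (auto simp: unlift_def lift_sign_def)
    next
      case False
      have "s e = lift_sign W P e" using e False ne1 by (intro s(2)) (auto simp: lift_ends_def)
      then show ?thesis using False ne1 by (auto simp: unlift_def lift_sign_def)
    qed
  qed
qed

lemma outflow_lift_sign:
  assumes "y \<in> W" "a \<in> W"
  shows "outflow (E - {e2}) (lift_ends e1 a b g) (lift_sign W P) W = outflow E g P W"
  unfolding outflow_unlift[symmetric]
proof (rule outflow_cong)
  fix e assume e: "e \<in> E" "(fst (g e) \<in> W) \<noteq> (snd (g e) \<in> W)"
  have "e \<noteq> e1" using e(2) lift_ends_cases(3) assms by metis
  moreover have "b \<notin> W" if "e = e2" using e(2) lift_ends_cases(4) assms that by metis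
  ultimately show "unlift g e1 e2 y (lift_sign W P) e = P e"
    by (cases "e = e2") (auto simp: unlift_def lift_sign_def)
qed

text \<open>Every set that loses two edges needs slack: \<open>loose\<close> provides it for sets
  with two vertices besides \<open>y\<close>, and \<open>na\<close> for the sets {y, x}. The
  hypothesis \<open>out\<close> protects the comparison of the cuts of \<open>W\<close> and
  \<open>W - Y\<close>: edges of \<open>y\<close> leaving \<open>W\<close> are lifted before the
  others.\<close>

lemma admissible_lift:
  assumes i: "admissible K E g P W Y L t" and K: "K \<ge> 3" "odd K" and y: "y \<in> Y" and a: "a \<in> W - Y"
    and loose: "\<And>S. S \<subseteq> W \<Longrightarrow> card (S - Y) \<ge> 2 \<Longrightarrow> \<not> W - Y \<subseteq> S \<Longrightarrow> demand K (L \<union> Y) t S < cut E g S"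
    and na: "\<And>x. x \<in> W - Y \<Longrightarrow> 2 * int (card (between E g y x)) < cut E g {y}"
    and out: "b \<in> W \<Longrightarrow> edge_cut E g {y} \<subseteq> {e\<in>E. fst (g e) \<in> W \<and> snd (g e) \<in> W}"
  shows "admissible K (E - {e2}) (lift_ends e1 a b g) (lift_sign W P) W Y L t"
proof -
  note D = admissibleD[OF i]
  let ?h = "lift_ends e1 a b g"
  have Yy: "Y = {y}" using D(7) y by auto
  have yW: "y \<in> W" using D(4) y by auto
  show ?thesis
    unfolding admissible_def
  proof (intro conjI)
    show "finite (E - {e2})" "signs (E - {e2}) (lift_sign W P)" using fin signs_lift D(2) by auto
    show "\<forall>y\<in>Y. \<forall>y'\<in>Y. y = y'" "\<forall>y\<in>Y. t y = 0" using D(7,8) by auto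
    show "\<forall>x\<in>W. even (t x - cut (E - {e2}) ?h {x})"
      using D(13) unfolding cut_lift by (auto simp: algebra_simps)
    show "2 * K dvd outflow (E - {e2}) ?h (lift_sign W P) W - sum t W"
      using D(14) outflow_lift_sign[OF yW] a by auto
    show "cut (E - {e2}) ?h W \<le> demand K (L \<union> Y) t W"
      unfolding cut_lift using D(16) yW a by auto
    show "\<forall>S. S \<subseteq> W \<longrightarrow> \<not> S \<subseteq> Y \<longrightarrow> \<not> W - Y \<subseteq> S \<longrightarrow> demand K (L \<union> Y) t S \<le> cut (E - {e2}) ?h S"
    proof (intro allI impI)
      fix S assume S: "S \<subseteq> W" "\<not> S \<subseteq> Y" "\<not> W - Y \<subseteq> S"
      have fS: "finite (S - Y)" using S(1) D(3) finite_subset by auto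
      show "demand K (L \<union> Y) t S \<le> cut (E - {e2}) ?h S"
      proof (cases "(a \<in> S \<longleftrightarrow> b \<in> S) \<and> (a \<in> S \<longleftrightarrow> y \<notin> S)")
        case False
        then show ?thesis unfolding cut_lift using D(15)[OF S] by auto
      next
        case aff: True
        have "demand K (L \<union> Y) t S < cut E g S"
        proof (cases "card (S - Y) \<ge> 2")
          case True
          then show ?thesis using loose S by blast
        next
          case False
          have "card (S - Y) \<noteq> 0" using S(2) fS by simp
          then have "card (S - Y) = 1" using False by linarith
          then obtain x where x: "S - Y = {x}" by (auto simp: card_1_singleton_iff)
          have "y \<in> S"
          proof (rule ccontr)
            assume "y \<notin> S"
            then have "a \<in> S - Y" "b \<in> S - Y" using aff Yy ab by auto
            then show False using x ab by auto
          qed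
          then have Sx: "S = {y, x}" "x \<noteq> y" using x Yy by auto
          have xN: "x \<in> W - Y" using x S(1) by auto
          \<comment> \<open>Adding \<open>y\<close> to {x} keeps the demand but enlarges the cut,
            since less than half of the edges at \<open>y\<close> lead to \<open>x\<close>.\<close>
          have "demand K (L \<union> Y) t {x} \<le> cut E g {x}" using xN S(3) Sx by (intro D(15)) auto
          moreover have "demand K (L \<union> Y) t S = demand K (L \<union> Y) t {x}"
            using Sx D(8)[OF y] y by (auto simp: demand_def)
          moreover have "cut E g S = cut E g {y} + cut E g {x} - 2 * int (card (between E g y x))"
            unfolding Sx using Sx by (intro cut_pair[OF fin]) auto
          ultimately show ?thesis using na[OF xN] by linarith
        qed
        then show ?thesis using admissible_slack[OF i K S(1)] aff unfolding cut_lift by auto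
      qed
    qed
    show "cut (E - {e2}) ?h W \<le> cut (E - {e2}) ?h (W - Y)"
    proof (cases "b \<in> W")
      case False
      then show ?thesis unfolding cut_lift using D(17) yW y a by auto
    next
      case True
      have N: "W = (W - Y) \<union> {y}" "(W - Y) \<inter> {y} = {}" using Yy yW by auto
      \<comment> \<open>No edge at \<open>y\<close> leaves \<open>W\<close>, so the cut of
        \<open>W - Y\<close> exceeds that of \<open>W\<close> by the degree of \<open>y\<close>.
        This is at least 2 and covers the two edges lost.\<close>
      have "{e\<in>E. (fst (g e) \<in> W - Y \<and> snd (g e) \<in> {y}) \<or> (fst (g e) \<in> {y} \<and> snd (g e) \<in> W - Y)}
          = edge_cut E g {y}"
        using out[OF True] unfolding Yy by (auto simp: edge_cut_def)
      then have "cut E g W = cut E g (W - Y) - cut E g {y}"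
        using cut_Un[OF fin N(2), of g] N(1) by (simp add: cut_def)
      moreover have "{e1, e2} \<subseteq> edge_cut E g {y}"
        using e1 e2 ab edge_cut_point by (metis empty_subsetI insert_subset)
      then have "card {e1, e2} \<le> card (edge_cut E g {y})"
        using fin by (intro card_mono) (auto simp: edge_cut_def)
      then have "2 \<le> cut E g {y}" using lift_split(1) by (simp add: cut_def)
      ultimately show ?thesis unfolding cut_lift using yW a y by auto
    qed
  qed (use D in auto)
qed

end

text \<open>If an edge at \<open>y\<close> leaves \<open>W\<close>, its partner must go to
  \<open>W - Y\<close>; without such a partner the cut of \<open>W\<close> would exceed that of
  \<open>W - Y\<close>, against the last clause of \<open>admissible\<close>. If none leaves,
  \<open>na\<close> prevents all edges at \<open>y\<close> from having the same other end.\<close>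

lemma lift_exists:
  assumes i: "admissible K E g P W Y L t" and y: "y \<in> Y"
    and na: "\<And>x. x \<in> W - Y \<Longrightarrow> 2 * int (card (between E g y x)) < cut E g {y}"
  shows "\<exists>e1 e2 a b. e1 \<in> between E g y a \<and> e2 \<in> between E g y b \<and> a \<noteq> b \<and> a \<noteq> y \<and> b \<noteq> y \<and> a \<in> W - Y \<and>
     (b \<in> W \<longrightarrow> edge_cut E g {y} \<subseteq> {e\<in>E. fst (g e) \<in> W \<and> snd (g e) \<in> W})"
proof -
  note D = admissibleD[OF i]
  have Yy: "Y = {y}" using D(7) y by auto
  have yW: "y \<in> W" using D(4) y by auto
  obtain x where "x \<in> W - Y" using D(6) by auto
  from na[OF this] have pos: "cut E g {y} > 0" by linarith
  show ?thesis
  proof (cases "edge_cut E g {y} \<subseteq> {e\<in>E. fst (g e) \<in> W \<and> snd (g e) \<in> W}")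
    case True
    have "edge_cut E g {y} \<noteq> {}" using pos by (auto simp: cut_def)
    then obtain e1 a where e1: "e1 \<in> between E g y a" "a \<noteq> y" "e1 \<in> edge_cut E g {y}"
      using edge_cut_point by (metis ex_in_conv)
    have a: "a \<in> W - Y" using e1 True Yy by (auto simp: between_def)
    have "int (card (between E g y a)) < int (card (edge_cut E g {y}))"
      using na[OF a] by (simp add: cut_def)
    then have "\<not> edge_cut E g {y} \<subseteq> between E g y a"
      using D(1) card_mono[of "between E g y a" "edge_cut E g {y}"] by (auto simp: between_def)
    then obtain e2 b where "e2 \<in> between E g y b" "b \<noteq> y" "e2 \<notin> between E g y a"
      using edge_cut_point by (metis subsetI)
    then show ?thesis using e1 a True by (metis)
  next
    case False
    then obtain e2 b where e2: "e2 \<in> between E g y b" "b \<noteq> y" "b \<notin> W"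
      using yW by (auto simp: edge_cut_def between_def)
    have "\<exists>e1 a. e1 \<in> between E g y a \<and> a \<in> W - Y"
    proof (rule ccontr)
      assume no: "\<not> ?thesis"
      have N: "W = (W - Y) \<union> {y}" "(W - Y) \<inter> {y} = {}" using Yy yW by auto
      have z: "{e\<in>E. (fst (g e) \<in> W - Y \<and> snd (g e) \<in> {y}) \<or> (fst (g e) \<in> {y} \<and> snd (g e) \<in> W - Y)} = {}"
        using no unfolding between_def by blast
      have "cut E g W = cut E g (W - Y) + cut E g {y}"
        using cut_Un[OF D(1) N(2), of g] N(1) unfolding z by simp
      then show False using pos D(17) by linarith
    qed
    then show ?thesis using e2 Yy by (metis DiffD1 DiffD2 singletonI)
  qed
qed

section \<open>Changing the class of a vertex: zero and shifted targets\<close>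

text \<open>Turning \<open>y\<close> into the vertex to be dissolved moves some sets to the lower
  case of \<open>demand\<close>, which by \<open>abs_le_circ_abs\<close> asks for no more. With four
  vertices \<open>W\<close> is not among them, so the bound on the fixed edges is preserved.\<close>

lemma admissible_zero:
  assumes i: "admissible K E g P W {} L t" and K: "K \<ge> 3" and y: "y \<in> W" "t y = 0" and W: "card W \<ge> 4"
  shows "admissible K E g P W {y} (L - {y}) t"
proof -
  note D = admissibleD[OF i]
  have fL: "finite L" using admissible_finite[OF i] by simp
  have U: "L - {y} \<union> {y} = insert y L" by auto
  have big: "\<not> W \<subseteq> insert y L" "\<not> W - {y} \<subseteq> L"
  proof -
    have "card (insert y L) \<le> 3" using D(9) card_insert_le_m1[of 3 L y] by simp
    then show 1: "\<not> W \<subseteq> insert y L" using card_mono[of "insert y L" W] fL W by auto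
    then show "\<not> W - {y} \<subseteq> L" by auto
  qed
  have sy: "sum t (S - {y}) = sum t S" if "S \<subseteq> W" for S
    using finite_subset[OF that D(3)] y(2) by (intro sum.mono_neutral_left) auto
  have W0: "W - {y} \<noteq> {}" using big by auto
  show ?thesis
    unfolding admissible_def U
  proof (intro conjI)
    show "L - {y} \<subseteq> W - {y}" "{y} \<subseteq> W" using D(5) y by auto
    show "card (L - {y}) \<le> 2" using D(9) card_mono[OF fL, of "L - {y}"] by auto
    show "\<forall>S. S \<subseteq> W \<longrightarrow> \<not> S \<subseteq> {y} \<longrightarrow> \<not> W - {y} \<subseteq> S \<longrightarrow> demand K (insert y L) t S \<le> cut E g S"
    proof (intro allI impI)
      fix S assume S: "S \<subseteq> W" "\<not> S \<subseteq> {y}" "\<not> W - {y} \<subseteq> S"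
      have c: "demand K L t S \<le> cut E g S" using S D(15)[of S] by auto
      show "demand K (insert y L) t S \<le> cut E g S"
      proof (cases "S \<subseteq> insert y L \<and> \<not> S \<subseteq> L")
        case True
        have "\<bar>sum t (S - {y})\<bar> \<le> 2 * K - 1" using True by (intro low_sum[OF i K]) auto
        then have "\<bar>sum t S\<bar> \<le> circ_abs K (sum t S) + (2 * K - 2)"
          using sy[OF S(1)] K by (intro abs_le_circ_abs) auto
        then show ?thesis using True c by (simp add: demand_def)
      next
        case False
        then have "S \<subseteq> insert y L \<longleftrightarrow> S \<subseteq> L" by auto
        then show ?thesis using c by (simp add: demand_def)
      qed
    qed
    have r: "demand K (insert y L) t W = demand K L t W" using big by (auto simp: demand_def)
    then show "cut E g W \<le> demand K (insert y L) t W" using D(16) by simp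
    have "demand K L t (W - {y}) = demand K L t W" using big sy[of W] by (auto simp: demand_def)
    moreover have "demand K L t (W - {y}) \<le> cut E g (W - {y})"
      using D(15)[of "W - {y}"] W0 y by auto
    ultimately show "cut E g W \<le> cut E g (W - {y})" using D(16) by simp
  qed (use D y W0 in auto)
qed

text \<open>The shift by 2K goes against the sign of \<open>t x\<close>. As \<open>t x\<close> is
  nonzero and at most K in absolute value, the result is at most 2K - 1 in absolute value and
  opposite in sign to the target of a vertex already in \<open>L\<close>.\<close>

lemma admissible_flip:
  assumes i: "admissible K E g P W {} L t" and K: "K \<ge> 3" and x: "x \<in> W - L" "t x \<noteq> 0" and W: "card W \<ge> 4"
    and L: "card L \<le> 1" "\<And>u. u \<in> L \<Longrightarrow> t u * t x > 0"
  shows "\<exists>t'. admissible K E g P W {} (insert x L) t' \<and> (\<forall>v. 2 * K dvd t' v - t v)"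
proof -
  note D = admissibleD[OF i]
  have fL: "finite L" using admissible_finite[OF i] by simp
  define d where "d = (if t x > 0 then - 2 * K else 2 * K)"
  define t' where "t' = t(x := t x + d)"
  have tx: "\<bar>t x\<bar> \<le> K" using D(12) x by auto
  have dv: "2 * K dvd t' v - t v" for v by (auto simp: t'_def d_def)
  have t'x: "\<bar>t' x\<bar> \<le> 2 * K - 1" "t x > 0 \<Longrightarrow> t' x \<le> 0" "t x < 0 \<Longrightarrow> t' x \<ge> 0"
    using tx x(2) K by (auto simp: t'_def d_def)
  have t'o: "t' v = t v" if "v \<noteq> x" for v using that by (simp add: t'_def)
  have card: "card (insert x L) \<le> 2" using L(1) fL x by simp
  have opp: "t' u * t' v \<le> 0" if "u \<in> insert x L" "v \<in> insert x L" "u \<noteq> v" for u v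
  proof -
    have *: "t' x * t' w \<le> 0" if "w \<in> L" for w
    proof -
      have "w \<noteq> x" using that x by auto
      then show ?thesis using L(2)[OF that] t'x(2,3) t'o
        by (auto simp: zero_less_mult_iff mult_le_0_iff)
    qed
    have "u = v" if "u \<in> L" "v \<in> L" using that L(1) fL card_le_Suc0_iff_eq by fastforce
    then show ?thesis using that * by (auto simp: mult.commute)
  qed
  have bnd: "\<And>v. v \<in> insert x L \<Longrightarrow> \<bar>t' v\<bar> \<le> 2 * K - 1" using D(11) t'x(1) t'o by fastforce
  have sum_x: "sum t' S = sum t S" if "x \<notin> S" for S using that by (intro sum.cong) (auto simp: t'_def)
  have sum_d: "2 * K dvd sum t' S - sum t S" for S
    unfolding sum_subtractf[symmetric] using dv by (intro dvd_sum) auto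
  \<comment> \<open>So \<open>W\<close> stays in the higher case of \<open>demand\<close>, where the
    shift is invisible.\<close>
  have big: "\<not> W \<subseteq> insert x L" using card_mono[of "insert x L" W] fL card W by auto
  show ?thesis
  proof (intro exI[of _ t'] conjI allI)
    show "2 * K dvd t' v - t v" for v by (rule dv)
    show "admissible K E g P W {} (insert x L) t'"
      unfolding admissible_def
    proof (intro conjI)
      show "insert x L \<subseteq> W - {}" using D(5) x by auto
      show "\<forall>u\<in>insert x L. \<forall>v\<in>insert x L. u \<noteq> v \<longrightarrow> t' u * t' v \<le> 0" using opp by blast
      show "\<forall>x\<in>insert x L. \<bar>t' x\<bar> \<le> 2 * K - 1" using bnd by blast
      show "\<forall>v\<in>W - {} - insert x L. \<bar>t' v\<bar> \<le> K" using D(12) t'o by auto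
      show "\<forall>v\<in>W. even (t' v - cut E g {v})"
      proof
        fix v assume "v \<in> W"
        then have "even (t v - cut E g {v})" using D(13) by blast
        moreover have "even (t' v - t v)" using dv[of v] by (metis dvd_mult_left)
        ultimately show "even (t' v - cut E g {v})" by presburger
      qed
      have "2 * K dvd (outflow E g P W - sum t W) - (sum t' W - sum t W)"
        by (rule dvd_diff[OF D(14) sum_d])
      then show "2 * K dvd outflow E g P W - sum t' W" by (simp only: diff_diff_eq2 diff_add_cancel)
      have demand': "demand K (insert x L \<union> {}) t' S \<le> demand K (L \<union> {}) t S" for S
      proof (cases "x \<in> S")
        case False
        then have "S \<subseteq> insert x L \<longleftrightarrow> S \<subseteq> L" by auto
        then show ?thesis using sum_x[OF False] by (simp add: demand_def)
      next
        case True
        have n: "circ_abs K (sum t' S) = circ_abs K (sum t S)" by (rule circ_abs_cong[OF sum_d])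
        have "\<bar>sum t' S\<bar> \<le> circ_abs K (sum t' S) + (2 * K - 2)" if "S \<subseteq> insert x L"
          using low_sum_gen[OF K, of S "insert x L" "{}" t'] that fL card opp bnd K
          by (intro abs_le_circ_abs) auto
        moreover have "\<not> S \<subseteq> L" using True x by auto
        ultimately show ?thesis using n by (cases "S \<subseteq> insert x L") (auto simp: demand_def)
      qed
      show "\<forall>S. S \<subseteq> W \<longrightarrow> \<not> S \<subseteq> {} \<longrightarrow> \<not> W - {} \<subseteq> S \<longrightarrow> demand K (insert x L \<union> {}) t' S \<le> cut E g S"
        using D(15) demand' by (meson order_trans)
      have "demand K (insert x L \<union> {}) t' W = demand K (L \<union> {}) t W"
        using big circ_abs_cong[OF sum_d, of W] by (auto simp: demand_def)
      then show "cut E g W \<le> demand K (insert x L \<union> {}) t' W" using D(16) by simp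
    qed (use D card in auto)
  qed
qed

lemma solvable_cong:
  assumes "\<And>v. 2 * K dvd t' v - t v" "solvable K E g P W t'"
  shows "solvable K E g P W t"
proof -
  have "2 * K dvd a - t v" if "2 * K dvd a - t' v" for a v
    using dvd_add[OF that assms(1)[of v]] by (simp only: add_diff_eq diff_add_cancel)
  then show ?thesis using assms(2) unfolding solvable_def by blast
qed

section \<open>Directing and deleting an edge\<close>

lemma demand_shift:
  assumes "K \<ge> 3" "\<bar>sum t' S - sum t S\<bar> \<le> 1"
  shows "demand K U t' S \<le> demand K U t S + 1"
proof -
  have "circ_abs K (sum t' S) \<le> circ_abs K (sum t S) + circ_abs K (sum t' S - sum t S)"
    using circ_abs_triangle[of K "sum t S" "sum t' S - sum t S"] assms by simp
  moreover have "circ_abs K (sum t' S - sum t S) \<le> 1" using circ_abs_le_abs[of K "sum t' S - sum t S"] assms by simp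
  ultimately show ?thesis using assms by (auto simp: demand_def)
qed

context
  fixes E :: "'e set" and g :: "'e \<Rightarrow> 'v \<times> 'v" and e :: 'e and x x' :: 'v
  assumes fin: "finite E" and e: "e \<in> between E g x x'" and xx: "x \<noteq> x'"
begin

lemma between_ends:
  "e \<in> E" "fst (g e) = x \<and> snd (g e) = x' \<or> fst (g e) = x' \<and> snd (g e) = x"
  using e by (auto simp: between_def)

lemma cut_delete: "cut (E - {e}) g S = cut E g S - (if (x \<in> S) \<noteq> (x' \<in> S) then 1 else 0)"
  unfolding cut_sum[OF fin] cut_sum[OF finite_Diff[OF fin]] sum.remove[OF fin between_ends(1)]
  using between_ends(2) by auto

lemma outflow_delete: "outflow E g s S = outflow (E - {e}) g s S +
    s e * (of_bool (fst (g e) \<in> S) - of_bool (snd (g e) \<in> S))"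
  unfolding outflow_def sum.remove[OF fin between_ends(1)] by simp

text \<open>At each end alone, cut and demand both drop by 1. A larger set separating the ends has
  slack 2 by \<open>loose\<close>. For all other sets neither the cut nor the sum changes.\<close>

lemma admissible_direct:
  assumes i: "admissible K E g P W {} L t" and K: "K \<ge> 3" "odd K" and W: "x \<in> W" "x' \<in> W"
    and t: "t x > 0" "t x' < 0"
    and loose: "\<And>S. S \<subseteq> W \<Longrightarrow> card S \<ge> 2 \<Longrightarrow> \<not> W \<subseteq> S \<Longrightarrow> demand K L t S < cut E g S"
  shows "admissible K (E - {e}) g P W {} L (t(x := t x - 1, x' := t x' + 1))" (is "admissible K _ g P W {} L ?t")
proof -
  note D = admissibleD[OF i]
  have t': "?t x = t x - 1" "?t x' = t x' + 1" "v \<noteq> x \<Longrightarrow> v \<noteq> x' \<Longrightarrow> ?t v = t v" for v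
    using xx by auto
  have abs': "\<bar>?t v\<bar> \<le> \<bar>t v\<bar>" for v using t xx by auto
  have sg: "(t v \<le> 0 \<longrightarrow> ?t v \<le> 0) \<and> (0 \<le> t v \<longrightarrow> 0 \<le> ?t v)" for v using t xx by auto
  have sums: "sum ?t S = sum t S - of_bool (x \<in> S) + of_bool (x' \<in> S)" if "S \<subseteq> W" for S
  proof -
    have f: "finite S" using that D(3) finite_subset by auto
    have "?t v = t v - of_bool (v = x) + of_bool (v = x')" for v using xx by auto
    then have "sum ?t S = (\<Sum>v\<in>S. t v - of_bool (v = x) + of_bool (v = x'))" by presburger
    also have "\<dots> = sum t S - of_bool (x \<in> S) + of_bool (x' \<in> S)"
      using f by (simp add: sum.distrib sum_subtractf of_bool_def sum.delta)
    finally show ?thesis .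
  qed
  show ?thesis
    unfolding admissible_def
  proof (intro conjI)
    show "signs (E - {e}) P" using D(2) by (auto simp: signs_def)
    show "\<forall>u\<in>L. \<forall>v\<in>L. u \<noteq> v \<longrightarrow> ?t u * ?t v \<le> 0"
      using D(10) sg unfolding mult_le_0_iff by blast
    show "\<forall>x\<in>L. \<bar>?t x\<bar> \<le> 2 * K - 1" using D(11) abs' order_trans by blast
    show "\<forall>x\<in>W - {} - L. \<bar>?t x\<bar> \<le> K" using D(12) abs' order_trans by blast
    show "\<forall>v\<in>W. even (?t v - cut (E - {e}) g {v})"
    proof
      fix v assume "v \<in> W"
      then have "even (t v - cut E g {v})" using D(13) by blast
      then show "even (?t v - cut (E - {e}) g {v})"
        unfolding cut_delete using xx by (cases "v = x"; cases "v = x'") auto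
    qed
    have "outflow (E - {e}) g P W = outflow E g P W"
      unfolding outflow_delete using between_ends(2) W by auto
    then show "2 * K dvd outflow (E - {e}) g P W - sum ?t W"
      using D(14) sums[of W] W by simp
    have "demand K (L \<union> {}) ?t W = demand K (L \<union> {}) t W" using sums[of W] W by (simp add: demand_def)
    then show "cut (E - {e}) g W \<le> demand K (L \<union> {}) ?t W"
      unfolding cut_delete using W D(16) by simp
    show "\<forall>S. S \<subseteq> W \<longrightarrow> \<not> S \<subseteq> {} \<longrightarrow> \<not> W - {} \<subseteq> S \<longrightarrow> demand K (L \<union> {}) ?t S \<le> cut (E - {e}) g S"
    proof (intro allI impI)
      fix S assume S: "S \<subseteq> W" "\<not> S \<subseteq> {}" "\<not> W - {} \<subseteq> S"
      have f: "finite S" using S(1) D(3) finite_subset by auto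
      note c = D(15)[OF S]
      show "demand K (L \<union> {}) ?t S \<le> cut (E - {e}) g S"
      proof (cases "(x \<in> S) \<noteq> (x' \<in> S)")
        case False
        then have "sum ?t S = sum t S" using sums[OF S(1)] by auto
        then have "demand K (L \<union> {}) ?t S = demand K (L \<union> {}) t S" by (simp only: demand_def)
        then show ?thesis using c False unfolding cut_delete by auto
      next
        case sep: True
        show ?thesis
        proof (cases "card S \<ge> 2")
          case True
          then have "demand K (L \<union> {}) t S < cut E g S" using loose S by auto
          then have "demand K (L \<union> {}) t S + 2 \<le> cut E g S" by (rule admissible_slack[OF i K S(1)])
          moreover have "demand K (L \<union> {}) ?t S \<le> demand K (L \<union> {}) t S + 1"
            using sums[OF S(1)] sep by (intro demand_shift[OF K(1)]) auto
          ultimately show ?thesis using sep unfolding cut_delete by auto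
        next
          case False
          have "card S \<noteq> 0" using S(2) f by auto
          then have "card S = 1" using False by linarith
          then obtain v where v: "S = {v}" by (auto simp: card_1_singleton_iff)
          then have vx: "v = x \<or> v = x'" using sep by auto
          then have a: "\<bar>?t v\<bar> = \<bar>t v\<bar> - 1" using t xx by auto
          have "demand K (L \<union> {}) ?t S = demand K (L \<union> {}) t S - 1"
          proof (cases "v \<in> L")
            case True
            then show ?thesis using a v by (simp add: demand_def)
          next
            case False
            then have "\<bar>t v\<bar> \<le> K" using D(12) S v by auto
            then have "circ_abs K (t v) = \<bar>t v\<bar>" "circ_abs K (?t v) = \<bar>?t v\<bar>"
              using a K by (intro circ_abs_small; linarith)+
            then show ?thesis using a v False by (simp add: demand_def)
          qed
          then show ?thesis using c sep unfolding cut_delete by auto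
        qed
      qed
    qed
  qed (use D in auto)
qed

lemma solvable_direct:
  assumes W: "x \<in> W" "x' \<in> W" and s: "solvable K (E - {e}) g P W (t(x := t x - 1, x' := t x' + 1))"
  shows "solvable K E g P W t"
proof -
  obtain s where s: "signs (E - {e}) s"
    "\<And>e'. e' \<in> E - {e} \<Longrightarrow> \<not> (fst (g e') \<in> W \<and> snd (g e') \<in> W) \<Longrightarrow> s e' = P e'"
    "\<And>v. v \<in> W \<Longrightarrow> 2 * K dvd outflow (E - {e}) g s {v} - (t(x := t x - 1, x' := t x' + 1)) v"
    using s unfolding solvable_def by blast
  define r where "r = s(e := if fst (g e) = x then 1 else - 1)"
  have o: "outflow (E - {e}) g r S = outflow (E - {e}) g s S" for S
    by (intro outflow_cong) (auto simp: r_def)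
  show ?thesis
    unfolding solvable_def
  proof (intro exI[of _ r] conjI ballI impI)
    show "signs E r" using s(1) by (auto simp: signs_def r_def)
  next
    fix e' assume "e' \<in> E" "\<not> (fst (g e') \<in> W \<and> snd (g e') \<in> W)"
    moreover have "e' \<noteq> e" using calculation between_ends(2) W by auto
    ultimately show "r e' = P e'" using s(2)[of e'] by (simp add: r_def)
  next
    fix v assume v: "v \<in> W"
    have "outflow E g r {v} - t v = outflow (E - {e}) g s {v} - (t(x := t x - 1, x' := t x' + 1)) v"
      unfolding outflow_delete o using between_ends(2) xx by (auto simp: r_def)
    then show "2 * K dvd outflow E g r {v} - t v" using s(3)[OF v] by metis
  qed
qed

end

section \<open>Connectedness and heavily joined pairs\<close>

text \<open>Otherwise the cut of \<open>W\<close> would be the sum of the two cuts and exceed its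
  upper bound by at least 3K - 5. Applied to the positive and the negative targets, this supplies an
  edge to direct.\<close>

lemma admissible_connected:
  assumes i: "admissible K E g P W {} L t" and K: "K \<ge> 3" and AB: "W = A \<union> B" "A \<inter> B = {}" "A \<noteq> {}" "B \<noteq> {}"
  shows "\<exists>x\<in>A. \<exists>x'\<in>B. \<exists>e. e \<in> between E g x x'"
proof (rule ccontr)
  assume no: "\<not> ?thesis"
  note D = admissibleD[OF i]
  have f: "finite A" "finite B" using D(3) AB(1) by auto
  have z: "{e\<in>E. (fst (g e) \<in> A \<and> snd (g e) \<in> B) \<or> (fst (g e) \<in> B \<and> snd (g e) \<in> A)} = {}"
    using no unfolding between_def by blast
  have "cut E g W = cut E g A + cut E g B" using cut_Un[OF D(1) AB(2), of g] AB(1) unfolding z by simp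
  moreover have "demand K (L \<union> {}) t A \<le> cut E g A" "demand K (L \<union> {}) t B \<le> cut E g B"
    using AB by (auto intro!: D(15)[simplified])
  moreover have "demand K (L \<union> {}) t W + (3 * K - 5) \<le> demand K (L \<union> {}) t A + demand K (L \<union> {}) t B"
    unfolding AB(1) by (rule demand_superadd[OF K f AB(2)])
  ultimately show False using D(16) K by linarith
qed

text \<open>For two vertices, twice the multiplicity is at least 3K - 5 >= 2K - 2. For three,
  superadditivity used twice makes the three multiplicities sum to at least 3(K - 2) + 1.\<close>

lemma admissible_fat:
  assumes i: "admissible K E g P W {} L t" and K: "K \<ge> 3" and W: "card W = 2 \<or> card W = 3"
  shows "\<exists>x y. x \<in> W \<and> y \<in> W \<and> x \<noteq> y \<and> K - 1 \<le> int (card (between E g x y))"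
  using W
proof
  note D = admissibleD[OF i]
  assume "card W = 2"
  then obtain x y where xy: "W = {x, y}" "x \<noteq> y" by (auto simp: card_2_iff)
  have "demand K (L \<union> {}) t {x} \<le> cut E g {x}" "demand K (L \<union> {}) t {y} \<le> cut E g {y}"
    using xy by (auto intro!: D(15)[simplified])
  moreover have "demand K (L \<union> {}) t W + (3 * K - 5) \<le> demand K (L \<union> {}) t {x} + demand K (L \<union> {}) t {y}"
    using demand_superadd[OF K, of "{x}" "{y}" "L \<union> {}" t] xy by (simp add: insert_commute)
  moreover have "cut E g W = cut E g {x} + cut E g {y} - 2 * int (card (between E g x y))"
    unfolding xy(1) by (rule cut_pair[OF D(1) xy(2)])
  ultimately have "K - 1 \<le> int (card (between E g x y))" using D(16) K by linarith
  then show ?thesis using xy by blast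
next
  note D = admissibleD[OF i]
  assume "card W = 3"
  then obtain x y z where xy: "W = {x, y, z}" "x \<noteq> y" "x \<noteq> z" "y \<noteq> z" by (auto simp: card_3_iff)
  let ?R = "demand K (L \<union> {}) t"
  have "?R {x} \<le> cut E g {x}" "?R {y} \<le> cut E g {y}" "?R {z} \<le> cut E g {z}"
    using xy by (auto intro!: D(15)[simplified])
  moreover have "?R {x, y} + (3 * K - 5) \<le> ?R {x} + ?R {y}"
    using demand_superadd[OF K, of "{x}" "{y}" "L \<union> {}" t] xy by (simp add: insert_commute)
  moreover have "?R W + (3 * K - 5) \<le> ?R {x, y} + ?R {z}"
    using demand_superadd[OF K, of "{x, y}" "{z}" "L \<union> {}" t] xy by (simp add: insert_commute)
  moreover have "cut E g {x, y} = cut E g {x} + cut E g {y} - 2 * int (card (between E g x y))"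
    by (rule cut_pair[OF D(1) xy(2)])
  moreover have "cut E g W = cut E g {x, y} + cut E g {z}
      - 2 * (int (card (between E g x z)) + int (card (between E g y z)))"
  proof -
    have "{e\<in>E. (fst (g e) \<in> {x, y} \<and> snd (g e) \<in> {z}) \<or> (fst (g e) \<in> {z} \<and> snd (g e) \<in> {x, y})}
        = between E g x z \<union> between E g y z" by (auto simp: between_def)
    moreover have "between E g x z \<inter> between E g y z = {}" using xy by (auto simp: between_def)
    then have "card (between E g x z \<union> between E g y z) = card (between E g x z) + card (between E g y z)"
      using D(1) by (intro card_Un_disjoint) (auto simp: between_def)
    moreover have "{x, y} \<union> {z} = W" using xy by auto
    ultimately show ?thesis using cut_Un[OF D(1), of "{x, y}" "{z}" g] xy by simp
  qed
  ultimately have "3 * K - 5 \<le> int (card (between E g x y)) + int (card (between E g x z))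
      + int (card (between E g y z))" using D(16) by (smt (verit))
  then have "K - 1 \<le> int (card (between E g x y)) \<or> K - 1 \<le> int (card (between E g x z))
      \<or> K - 1 \<le> int (card (between E g y z))" by presburger
  then show ?thesis using xy by blast
qed

section \<open>The induction\<close>

text \<open>Contraction removes a vertex of weight 3 and may move the merged one out of
  \<open>L\<close> at cost 1; starting a dissolution trades weight 3 for 1; a shift enlarges
  \<open>L\<close>; lifting and directing use up edges.\<close>

definition size_of :: "'e set \<Rightarrow> 'v set \<Rightarrow> 'v set \<Rightarrow> 'v set \<Rightarrow> nat" where
  "size_of E W Y L = card E + 3 * card (W - Y) + card (W - Y - L) + card Y"

lemma size_of_contract:
  assumes f: "finite W" and S: "S \<subseteq> W" "2 \<le> card (S - Y)" "w \<in> S - Y" "Y \<subseteq> W"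
    and L': "L - S \<subseteq> L'"
  shows "size_of E (W - S \<union> {w}) (Y - S) L' < size_of E W Y L"
proof -
  have fS: "finite S" "finite Y" using f S finite_subset by auto
  have "W - S \<union> {w} - (Y - S) = insert w (W - Y - (S - Y))" using S by auto
  moreover have "card (W - Y - (S - Y)) = card (W - Y) - card (S - Y)"
    using S f fS by (intro card_Diff_subset) auto
  moreover have "card (S - Y) \<le> card (W - Y)" using S f by (intro card_mono) auto
  moreover have "w \<notin> W - Y - (S - Y)" using S by auto
  moreover have "finite (W - Y - (S - Y))" using f by auto
  ultimately have a: "card (W - S \<union> {w} - (Y - S)) + card (S - Y) = card (W - Y) + 1"
    by simp
  have "W - S \<union> {w} - (Y - S) - L' \<subseteq> insert w (W - Y - L)" using S L' by auto
  then have "card (W - S \<union> {w} - (Y - S) - L') \<le> card (insert w (W - Y - L))"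
    using f by (intro card_mono) auto
  also have "\<dots> \<le> card (W - Y - L) + 1" using card_insert_le_m1 f by (simp add: card_insert_if)
  finally have b: "card (W - S \<union> {w} - (Y - S) - L') \<le> card (W - Y - L) + 1" .
  have "card (Y - S) \<le> card Y" using fS by (intro card_mono) auto
  then show ?thesis using a b S(2) unfolding size_of_def by linarith
qed

lemma size_of_restrict:
  assumes f: "finite W" and S: "S \<subseteq> W" "\<not> W - Y \<subseteq> S" "Y \<subseteq> W"
  shows "size_of E S (Y \<inter> S) (L \<inter> S) < size_of E W Y L"
proof -
  have fY: "finite Y" using f S finite_subset by auto
  have "card (S - Y \<inter> S) < card (W - Y)" using S f by (intro psubset_card_mono) auto
  moreover have "card (S - Y \<inter> S - L \<inter> S) \<le> card (W - Y - L)" using S f by (intro card_mono) auto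
  moreover have "card (Y \<inter> S) \<le> card Y" using fY by (intro card_mono) auto
  ultimately show ?thesis unfolding size_of_def by linarith
qed

text \<open>The order of the cases matters: tight cuts are split off first, so that the steps which
  lose edges find slack, and a dissolution is finished before another begins, which keeps
  \<open>Y\<close> at one vertex.\<close>

theorem admissible_solvable:
  fixes E :: "'e set" and g :: "'e \<Rightarrow> 'v \<times> 'v"
  assumes "admissible K E g P W Y L t" "K \<ge> 3" "odd K"
  shows "solvable K E g P W t"
  using assms
proof (induction "size_of E W Y L" arbitrary: E g P W Y L t rule: less_induct)
  case less
  note i = less.prems(1) and K = less.prems(2,3)
  note D = admissibleD[OF i]
  have IH: "solvable K E' g' P' W' t'" if "admissible K E' g' P' W' Y' L' t'" "size_of E' W' Y' L' < size_of E W Y L"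
    for E' :: "'e set" and g' :: "'e \<Rightarrow> 'v \<times> 'v" and P' W' Y' L' t'
    using less.hyps[OF that(2) that(1) K] .
  have fL: "finite L" "finite Y" using admissible_finite[OF i] by auto
  show ?case
  proof (cases "\<exists>S. S \<subseteq> W \<and> card (S - Y) \<ge> 2 \<and> \<not> W - Y \<subseteq> S \<and> \<not> demand K (L \<union> Y) t S < cut E g S")
    case True
    then obtain S where S: "S \<subseteq> W" "card (S - Y) \<ge> 2" "\<not> W - Y \<subseteq> S"
      and tight: "cut E g S \<le> demand K (L \<union> Y) t S" by (auto simp: not_less)
    obtain w where w: "w \<in> S - Y" using S(2) by (metis card.empty ex_in_conv not_numeral_le_zero)
    show ?thesis
    proof (rule solvable_glue[OF i K(1) S(1) w S(3) tight])
      show "solvable K E (contract S w g) P (W - S \<union> {w}) (contract_target K (L \<union> Y) S w t)"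
        by (intro IH[OF admissible_contract[OF i K(1) S(1) w]] size_of_contract[OF D(3) S(1,2) w D(4)]) auto
      show "solvable K E g s S t" if "admissible K E g s S (Y \<inter> S) (L \<inter> S) t" for s
        by (rule IH[OF that size_of_restrict[OF D(3) S(1,3) D(4)]])
    qed
  next
    case False
    then have loose: "demand K (L \<union> Y) t S < cut E g S"
      if "S \<subseteq> W" "card (S - Y) \<ge> 2" "\<not> W - Y \<subseteq> S" for S using that by blast
    show ?thesis
    proof (cases "Y = {}")
      case False
      then obtain y where y: "y \<in> Y" by auto
      have Yy: "Y = {y}" using D(7) y by auto
      show ?thesis
      proof (cases "\<exists>x\<in>W - Y. 2 * int (card (between E g y x)) \<ge> cut E g {y}")
        case True
        then obtain x where x: "x \<in> W - Y" "2 * int (card (between E g y x)) \<ge> cut E g {y}" by auto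
        let ?L = "if {y, x} \<subseteq> L \<union> Y then L - {y, x} \<union> {x} else L - {y, x}"
        have "?L = L" using y x D(5) by auto
        moreover have "W - {y, x} \<union> {x} - (Y - {y, x}) = W - Y" "Y - {y, x} = {}" using Yy x by auto
        ultimately have "size_of E (W - {y, x} \<union> {x}) (Y - {y, x}) ?L < size_of E W Y L"
          using Yy by (simp add: size_of_def)
        then show ?thesis using y x D(4)
          by (intro solvable_absorb[OF i K(1) y x] IH[OF admissible_contract[OF i K(1)]]) auto
      next
        case False
        then have na: "2 * int (card (between E g y x)) < cut E g {y}" if "x \<in> W - Y" for x
          using that by (auto simp: not_le)
        from lift_exists[OF i y na] obtain e1 e2 a b where
          e: "e1 \<in> between E g y a" "e2 \<in> between E g y b" "a \<noteq> b" "a \<noteq> y" "b \<noteq> y" "a \<in> W - Y"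
            "b \<in> W \<Longrightarrow> edge_cut E g {y} \<subseteq> {e\<in>E. fst (g e) \<in> W \<and> snd (g e) \<in> W}" by blast
        note i' = admissible_lift[OF D(1) e(1-5) i K y e(6) loose na e(7)]
        have "card (E - {e2}) < card E"
          using e(2) D(1) by (intro psubset_card_mono) (auto simp: between_def)
        then have "size_of (E - {e2}) W Y L < size_of E W Y L" by (simp add: size_of_def)
        from IH[OF i' this] show ?thesis
          using y D(4) e(6) by (intro solvable_lift[OF D(1) e(1-5)]) auto
      qed
    next
      case Y: True
      note i = i[unfolded Y]
      note D = admissibleD[OF i]
      have cW: "card W \<noteq> 0" using D(3,6) by auto
      consider "card W = 1" | "card W = 2 \<or> card W = 3" | "card W \<ge> 4" using cW by linarith
      then show ?thesis
      proof cases
        case 1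
        then obtain x where "W = {x}" by (auto simp: card_1_singleton_iff)
        \<comment> \<open>Every edge at the only vertex is fixed or a loop, and the congruence for
          \<open>W\<close> is the one for \<open>x\<close>.\<close>
        then show ?thesis using D(2,14) by (auto simp: solvable_def intro!: exI[of _ P])
      next
        case 2
        from admissible_fat[OF i K(1) 2] obtain x y where xy: "x \<in> W" "y \<in> W" "x \<noteq> y"
          "K - 1 \<le> int (card (between E g x y))" by blast
        have "admissible K E (contract {x, y} x g) P (W - {x, y} \<union> {x}) ({} - {x, y})
            (if {x, y} \<subseteq> L \<union> {} then L - {x, y} \<union> {x} else L - {x, y})
            (contract_target K (L \<union> {}) {x, y} x t)"
          using xy by (intro admissible_contract[OF i K(1)]) auto
        moreover have "size_of E (W - {x, y} \<union> {x}) ({} - {x, y})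
            (if {x, y} \<subseteq> L \<union> {} then L - {x, y} \<union> {x} else L - {x, y}) < size_of E W Y L"
          unfolding Y using xy by (intro size_of_contract[OF D(3)]) auto
        ultimately show ?thesis by (intro solvable_fat[OF i K(1) xy] IH)
      next
        case big: 3
        show ?thesis
        proof (cases "\<exists>y\<in>W. t y = 0")
          case True
          then obtain y where y: "y \<in> W" "t y = 0" by auto
          have "card (W - {y}) = card W - 1" using y D(3) by simp
          moreover have "card (W - {y} - (L - {y})) \<le> card (W - L)"
            using D(3) by (intro card_mono) auto
          ultimately have "size_of E W {y} (L - {y}) < size_of E W Y L"
            using big unfolding size_of_def Y by simp
          then show ?thesis using IH[OF admissible_zero[OF i K(1) y big]] by blast
        next
          case nz: False
          show ?thesis
          proof (cases "\<exists>x\<in>W. \<exists>x'\<in>W. \<exists>e. t x > 0 \<and> t x' < 0 \<and> e \<in> between E g x x'")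
            case True
            then obtain x x' e where x: "x \<in> W" "x' \<in> W" "t x > 0" "t x' < 0" "e \<in> between E g x x'"
              by blast
            then have xx: "x \<noteq> x'" by auto
            have i': "admissible K (E - {e}) g P W {} L (t(x := t x - 1, x' := t x' + 1))"
              using loose unfolding Y
              by (intro admissible_direct[OF D(1) x(5) xx i K x(1-4)]) auto
            have "card (E - {e}) < card E"
              using x(5) D(1) by (intro psubset_card_mono) (auto simp: between_def)
            then have "size_of (E - {e}) W {} L < size_of E W Y L" by (simp add: size_of_def Y)
            from IH[OF i' this] show ?thesis by (rule solvable_direct[OF D(1) x(5) xx x(1,2)])
          next
            case no: False
            let ?A = "{x\<in>W. t x > 0}" and ?B = "{x\<in>W. t x < 0}"
            \<comment> \<open>If both signs occurred, connectedness would give an edge to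
              direct.\<close>
            have "?A = {} \<or> ?B = {}"
              using admissible_connected[OF i K(1), of ?A ?B] no nz by fastforce
            then have same: "t u * t v > 0" if "u \<in> W" "v \<in> W" for u v
              using nz that unfolding zero_less_mult_iff by (smt (verit) Collect_empty_eq)
            \<comment> \<open>Two shifted vertices would have opposite signs. As all signs now
              agree, there is room for one more.\<close>
            have "u = v" if "u \<in> L" "v \<in> L" for u v
              using D(10)[OF that] same[of u v] D(5) that by force
            then have L1: "card L \<le> 1" using fL(1) by (simp add: card_le_Suc0_iff_eq)
            have "\<not> W \<subseteq> L" using card_mono[OF fL(1), of W] big L1 by auto
            then obtain x where x: "x \<in> W - L" by auto
            have "t x \<noteq> 0" "\<And>u. u \<in> L \<Longrightarrow> t u * t x > 0" using nz x same D(5) by auto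
            from admissible_flip[OF i K(1) x this(1) big L1 this(2)] obtain t' where
              t': "admissible K E g P W {} (insert x L) t'" "\<And>v. 2 * K dvd t' v - t v" by blast
            have "card (W - insert x L) < card (W - L)"
              using x D(3) by (intro psubset_card_mono) auto
            then have "size_of E W {} (insert x L) < size_of E W Y L" by (simp add: size_of_def Y)
            from IH[OF t'(1) this] show ?thesis
              using t'(2) by (intro solvable_cong[of K t' t])
          qed
        qed
      qed
    qed
  qed
qed

section \<open>From boundaries modulo K to targets modulo 2K\<close>

text \<open>K is odd, so a residue modulo K and a parity can be prescribed independently; adding K
  repairs the parity.\<close>

lemma target_exists:
  assumes K: "K \<ge> 3" "odd K"
  shows "\<exists>r::int. K dvd r - a \<and> even (r - c) \<and> \<bar>r\<bar> \<le> K"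
proof -
  define b where "b = (if even (a - c) then a else a + K)"
  have b: "K dvd b - a" "even (b - c)" using K(2) by (auto simp: b_def)
  obtain r where r: "2 * K dvd r - b" "\<bar>r\<bar> \<le> K" using circ_abs_rep[of K b] K by auto
  have "K dvd r - b" "even (r - b)" using r(1) by (metis dvd_mult_right, metis dvd_mult_left)
  then have "K dvd (r - b) + (b - a)" "even ((r - b) + (b - c))" using b by (metis dvd_add)+
  then show ?thesis using r(2) by (intro exI[of _ r]) simp
qed

theorem modulo_orientation:
  fixes K :: int and E :: "'e set" and g :: "'e \<Rightarrow> 'v \<times> 'v"
  assumes K: "K \<ge> 3" "odd K" and fin: "finite W" "finite E"
    and ends: "\<And>e. e \<in> E \<Longrightarrow> fst (g e) \<in> W \<and> snd (g e) \<in> W"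
    and con: "\<And>S. S \<subseteq> W \<Longrightarrow> S \<noteq> {} \<Longrightarrow> S \<noteq> W \<Longrightarrow> 6 * K - 7 \<le> cut E g S"
    and \<beta>: "K dvd sum \<beta> W"
  shows "\<exists>s. signs E s \<and> (\<forall>x\<in>W. K dvd outflow E g s {x} - \<beta> x)"
proof (cases "W = {}")
  case True
  then show ?thesis by (intro exI[of _ "\<lambda>_. 1"]) (auto simp: signs_def)
next
  case False
  have "\<exists>r. K dvd r - \<beta> x \<and> even (r - cut E g {x}) \<and> \<bar>r\<bar> \<le> K" for x
    by (rule target_exists[OF K])
  then obtain t where t: "\<And>x. K dvd t x - \<beta> x" "\<And>x. even (t x - cut E g {x})" "\<And>x. \<bar>t x\<bar> \<le> K"
    by metis
  have "edge_cut E g W = {}" using ends by (auto simp: edge_cut_def)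
  then have cW: "cut E g W = 0" by (simp add: cut_def)
  have oW: "outflow E g s W = 0" for s using ends by (simp add: outflow_def)
  have "K dvd sum t W - sum \<beta> W" unfolding sum_subtractf[symmetric] using t(1) by (intro dvd_sum) auto
  from dvd_add[OF this \<beta>] have 1: "K dvd sum t W" by simp
  have "even (\<Sum>x\<in>W. t x - cut E g {x})" using t(2) by (intro dvd_sum) auto
  then have 2: "even (sum t W)" using cut_even[OF fin(2,1), of g] cW by (simp add: sum_subtractf)
  \<comment> \<open>The boundary condition supplies the factor K, the even degree sum the factor
    2.\<close>
  have tW: "2 * K dvd sum t W" using 1 2 K(2) by (intro divides_mult) (auto simp: coprime_commute)
  have "admissible K E g (\<lambda>_. 1) W {} {} t"
    unfolding admissible_def
  proof (intro conjI)
    show "\<forall>S. S \<subseteq> W \<longrightarrow> \<not> S \<subseteq> {} \<longrightarrow> \<not> W - {} \<subseteq> S \<longrightarrow> demand K ({} \<union> {}) t S \<le> cut E g S"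
    proof (intro allI impI)
      fix S assume S: "S \<subseteq> W" "\<not> S \<subseteq> {}" "\<not> W - {} \<subseteq> S"
      then have "6 * K - 7 \<le> cut E g S" by (intro con) auto
      then show "demand K ({} \<union> {}) t S \<le> cut E g S"
        using S(2) circ_abs_le(1)[of K "sum t S"] K by (simp add: demand_def)
    qed
    show "cut E g W \<le> demand K ({} \<union> {}) t W"
      using cW K circ_abs_le(2)[of K "sum t W"] False by (simp add: demand_def)
  qed (use fin t tW oW False cW in \<open>auto simp: signs_def\<close>)
  from admissible_solvable[OF this K] obtain s where s: "signs E s"
    "\<And>x. x \<in> W \<Longrightarrow> 2 * K dvd outflow E g s {x} - t x" unfolding solvable_def by blast
  have "K dvd outflow E g s {x} - \<beta> x" if "x \<in> W" for x
  proof -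
    have "K dvd outflow E g s {x} - t x" using s(2)[OF that] by (metis dvd_mult_right)
    from dvd_add[OF this t(1)[of x]] show ?thesis by simp
  qed
  then show ?thesis using s(1) by blast
qed

section \<open>Weighted orientations\<close>

definition inner :: "'e set \<Rightarrow> ('e \<Rightarrow> 'v \<times> 'v) \<Rightarrow> 'v set \<Rightarrow> 'e set" where
  "inner E g S = {e\<in>E. fst (g e) \<in> S \<and> snd (g e) \<in> S}"

text \<open>Since |V| - 1 = (|A| - 1) + (|B| - 1) + 1, the at most \<open>c\<close> edges lost by
  splitting are paid for by the drop of the bound, so one side still exceeds its bound. The descent
  cannot end in a single vertex, which spans no edge.\<close>

lemma mader_subgraph:
  assumes "finite E" "finite V" "V \<noteq> {}"
    and loopfree: "\<And>e. e \<in> E \<Longrightarrow> fst (g e) \<noteq> snd (g e)"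
    and "c * (card V - 1) < card (inner E g V)"
  shows "\<exists>S \<subseteq> V. 2 \<le> card S \<and>
    (\<forall>A. A \<subseteq> S \<longrightarrow> A \<noteq> {} \<longrightarrow> A \<noteq> S \<longrightarrow> c < card (edge_cut (inner E g S) g A))"
  using assms(2,3,5)
proof (induction "card V" arbitrary: V rule: less_induct)
  case less
  show ?case
  proof (cases "\<forall>A. A \<subseteq> V \<longrightarrow> A \<noteq> {} \<longrightarrow> A \<noteq> V \<longrightarrow> c < card (edge_cut (inner E g V) g A)")
    case True
    have "card V \<noteq> 1"
    proof
      assume "card V = 1"
      then obtain x where "V = {x}" by (auto simp: card_1_singleton_iff)
      then have "inner E g V = {}" using loopfree by (force simp: inner_def)
      then show False using less.prems(3) by simp
    qed
    moreover have "card V \<noteq> 0" using less.prems by simp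
    ultimately have "2 \<le> card V" by linarith
    then show ?thesis using True by blast
  next
    case False
    then obtain A where A: "A \<subseteq> V" "A \<noteq> {}" "A \<noteq> V" "card (edge_cut (inner E g V) g A) \<le> c"
      by (auto simp: not_less)
    define B where "B = V - A"
    have B: "B \<subseteq> V" "B \<noteq> {}" "A \<union> B = V" "A \<inter> B = {}" using A B_def by auto
    have fAB: "finite A" "finite B" using less.prems(1) A B finite_subset by auto
    have cV: "card V = card A + card B" using card_Un_disjoint[OF fAB B(4)] B(3) by simp
    have pos: "card A \<ge> 1" "card B \<ge> 1" using fAB A B by (auto simp: Suc_le_eq card_gt_0_iff)
    have "inner E g V = inner E g A \<union> inner E g B \<union> edge_cut (inner E g V) g A"
      using B by (auto simp: inner_def edge_cut_def)
    then have "card (inner E g V) \<le> card (inner E g A \<union> inner E g B) + card (edge_cut (inner E g V) g A)"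
      using card_Un_le by metis
    also have "\<dots> \<le> card (inner E g A) + card (inner E g B) + c"
      using A(4) card_Un_le[of "inner E g A" "inner E g B"] by linarith
    finally have le: "card (inner E g V) \<le> card (inner E g A) + card (inner E g B) + c" .
    have "c * (card V - 1) = c * (card A - 1) + c * (card B - 1) + c"
    proof -
      have "card V - 1 = (card A - 1) + (card B - 1) + 1" using cV pos by linarith
      then show ?thesis by (simp add: algebra_simps)
    qed
    then have "c * (card A - 1) < card (inner E g A) \<or> c * (card B - 1) < card (inner E g B)"
      using le less.prems(3) by linarith
    then show ?thesis
    proof
      assume "c * (card A - 1) < card (inner E g A)"
      from less.hyps[OF _ fAB(1) A(2) this] cV pos obtain S where "S \<subseteq> A" "2 \<le> card S"
        "\<forall>A. A \<subseteq> S \<longrightarrow> A \<noteq> {} \<longrightarrow> A \<noteq> S \<longrightarrow> c < card (edge_cut (inner E g S) g A)" by auto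
      then show ?thesis using A(1) by blast
    next
      assume "c * (card B - 1) < card (inner E g B)"
      from less.hyps[OF _ fAB(2) B(2) this] cV pos obtain S where "S \<subseteq> B" "2 \<le> card S"
        "\<forall>A. A \<subseteq> S \<longrightarrow> A \<noteq> {} \<longrightarrow> A \<noteq> S \<longrightarrow> c < card (edge_cut (inner E g S) g A)" by auto
      then show ?thesis using B(1) by blast
    qed
  qed
qed

section \<open>Degree counting and weight classes\<close>

lemma handshake:
  assumes fin: "finite V" "finite E" and ends: "\<And>e. e \<in> E \<Longrightarrow> fst (g e) \<in> V \<and> snd (g e) \<in> V"
  shows "(\<Sum>x\<in>V. card (edge_cut E g {x})) = 2 * card {e\<in>E. fst (g e) \<noteq> snd (g e)}"
proof -
  have "(\<Sum>x\<in>V. card (edge_cut E g {x})) = card (SIGMA x:V. edge_cut E g {x})"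
    using fin by (simp add: card_SigmaI edge_cut_def)
  also have "\<dots> = card ((SIGMA e:{e\<in>E. fst (g e) \<noteq> snd (g e)}. {fst (g e), snd (g e)}))"
    using ends by (intro bij_betw_same_card[of prod.swap] bij_betw_byWitness[where f' = prod.swap])
      (auto simp: edge_cut_def)
  also have "\<dots> = (\<Sum>e\<in>{e\<in>E. fst (g e) \<noteq> snd (g e)}. card {fst (g e), snd (g e)})"
    using fin by (subst card_SigmaI) auto
  also have "\<dots> = (\<Sum>e\<in>{e\<in>E. fst (g e) \<noteq> snd (g e)}. 2)" by (intro sum.cong) auto
  finally show ?thesis by simp
qed

lemma heavy_class:
  fixes p :: nat and f :: "'e \<Rightarrow> int"
  assumes p: "p \<ge> 3" "odd p" and fin: "finite N" and f: "\<And>e. e \<in> N \<Longrightarrow> f e \<in> {1..<int p}"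
    and m: "m * (p - 1) \<le> 2 * card N"
  shows "\<exists>c. 1 \<le> c \<and> c < int p \<and> m \<le> card {e\<in>N. f e = c \<or> f e = int p - c}"
proof (rule ccontr)
  assume no: "\<not> ?thesis"
  \<comment> \<open>The number of classes {c, p - c}; each has exactly one representative in
    1..q.\<close>
  define q where "q = (p - 1) div 2"
  have q: "p = 2 * q + 1" "q \<ge> 1" using p by (auto simp: q_def)
  let ?C = "\<lambda>c. {e\<in>N. f e = c \<or> f e = int p - c}"
  have less: "card (?C c) < m" if "c \<in> {1..int q}" for c
  proof -
    have "1 \<le> c \<and> c < int p" using that q by auto
    then show ?thesis using no not_le by blast
  qed
  have "N = (\<Union>c\<in>{1..int q}. ?C c)"
  proof
    show "N \<subseteq> (\<Union>c\<in>{1..int q}. ?C c)"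
    proof
      fix e assume e: "e \<in> N"
      show "e \<in> (\<Union>c\<in>{1..int q}. ?C c)"
      proof (cases "f e \<le> int q")
        case True then show ?thesis using e f[OF e] by auto
      next
        case False then show ?thesis using e f[OF e] q by (intro UN_I[of "int p - f e"]) auto
      qed
    qed
  qed auto
  then have "card N \<le> (\<Sum>c\<in>{1..int q}. card (?C c))"
    using card_UN_le[of "{1..int q}" ?C] by simp
  also have "\<dots> < (\<Sum>c\<in>{1..int q}. m)" using less q by (intro sum_strict_mono) auto
  also have "\<dots> = q * m" by simp
  finally show False using m q by (simp add: algebra_simps)
qed

section \<open>Induction over contractions in the weighted problem\<close>

text \<open>Loops are allowed and \<open>\<beta>\<close> takes arbitrary integer values, so that the
  hypotheses survive contracting \<open>S\<close> and summing its boundary values.\<close>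

lemma weighted_orientation:
  fixes p :: nat and f :: "'e \<Rightarrow> int" and g :: "'e \<Rightarrow> 'v \<times> 'v"
  assumes p: "prime p" "p \<ge> 3" and fE: "finite E" and f: "\<And>e. e \<in> E \<Longrightarrow> f e \<in> {1..<int p}"
    and "finite V" "\<And>e. e \<in> E \<Longrightarrow> fst (g e) \<in> V \<and> snd (g e) \<in> V"
    and "edge_connected ((6 * p - 8) * (p - 1)) V E g"
    and "int p dvd sum \<beta> V"
  shows "\<exists>s. signs E s \<and> (\<forall>x\<in>V. int p dvd outflow E g (\<lambda>e. s e * f e) {x} - \<beta> x)"
  using assms(5-)
proof (induction "card V" arbitrary: V g \<beta> rule: less_induct)
  case less
  note fV = less.prems(1) and ends = less.prems(2) and con = less.prems(3) and \<beta> = less.prems(4)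
  have oddp: "odd p" using p prime_odd_nat by auto
  show ?case
  proof (cases "card V \<le> 1")
    case True
    have "outflow E g s {x} - \<beta> x = - sum \<beta> V" if "x \<in> V" for s x
    proof -
      have "V = {x}" using True that fV by (metis One_nat_def card_le_Suc0_iff_eq empty_iff insertI1 insert_iff subsetI subset_antisym singletonD)
      then show ?thesis using ends by (simp add: outflow_def)
    qed
    then show ?thesis using \<beta> by (intro exI[of _ "\<lambda>_. 1"]) (auto simp: signs_def)
  next
    case False
    let ?n = "card V" and ?k = "6 * p - 8"
    define N where "N = {e\<in>E. fst (g e) \<noteq> snd (g e)}"
    have fN: "finite N" using fE by (simp add: N_def)
    have "?n * (?k * (p - 1)) = (\<Sum>x\<in>V. ?k * (p - 1))" by simp
    also have "\<dots> \<le> (\<Sum>x\<in>V. card (edge_cut E g {x}))"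
    proof (rule sum_mono)
      fix x assume x: "x \<in> V"
      then have "{x} \<subseteq> V" "{x} \<noteq> {}" "{x} \<noteq> V" using False by auto
      then show "?k * (p - 1) \<le> card (edge_cut E g {x})" using con unfolding edge_connected_def by blast
    qed
    also have "\<dots> = 2 * card N" unfolding N_def using handshake[OF fV fE ends] .
    finally have "(?k * ?n) * (p - 1) \<le> 2 * card N" by (simp add: ac_simps)
    from heavy_class[OF p(2) oddp fN _ this, of f] f obtain c where
      c: "1 \<le> c" "c < int p" "?k * ?n \<le> card {e\<in>N. f e = c \<or> f e = int p - c}" by (auto simp: N_def)
    define M where "M = {e\<in>N. f e = c \<or> f e = int p - c}"
    have fM: "finite M" using fN by (simp add: M_def)
    have ME: "M \<subseteq> E" by (auto simp: M_def N_def)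
    have V0: "V \<noteq> {}" "card V \<ge> 1" using False by auto
    have "inner M g V = M" using ME ends by (auto simp: inner_def)
    \<comment> \<open>Replacing |V| by |V| - 1 yields the strict inequality that
      \<open>mader_subgraph\<close> asks for.\<close>
    moreover have "?k * (?n - 1) < ?k * ?n" using p V0 by simp
    ultimately have "?k * (?n - 1) < card (inner M g V)" using c(3) unfolding M_def[symmetric] by (metis order.strict_trans2)
    from mader_subgraph[OF fM fV V0(1) _ this] obtain S where
      S: "S \<subseteq> V" "2 \<le> card S"
      and cutS: "\<And>A. A \<subseteq> S \<Longrightarrow> A \<noteq> {} \<Longrightarrow> A \<noteq> S \<Longrightarrow> ?k < card (edge_cut (inner M g S) g A)"
      by (auto simp: M_def N_def)
    have fS: "finite S" using S fV finite_subset by auto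
    obtain w where w: "w \<in> S" using S(2) by (metis card.empty ex_in_conv not_numeral_le_zero)
    define F where "F = inner M g S"
    have fF: "finite F" "F \<subseteq> E" using fM ME by (auto simp: F_def inner_def)
    have Fends: "fst (g e) \<in> S \<and> snd (g e) \<in> S" if "e \<in> F" for e using that by (auto simp: F_def inner_def)
    let ?V = "V - S \<union> {w}" and ?g = "contract S w g" and ?\<beta> = "\<beta>(w := sum \<beta> S)"
    have "\<exists>s. signs E s \<and> (\<forall>x\<in>?V. int p dvd outflow E ?g (\<lambda>e. s e * f e) {x} - ?\<beta> x)"
    proof (rule less.hyps)
      have "card ?V = card V - card S + 1"
        using S w fV fS by (simp add: card_Diff_subset)
      moreover have "card S \<le> card V" using S fV by (intro card_mono)
      ultimately show "card ?V < card V" using S(2) by linarith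
      show "finite ?V" using fV by simp
      show "fst (?g e) \<in> ?V \<and> snd (?g e) \<in> ?V" if "e \<in> E" for e
        using ends[OF that] by (auto simp: contract_def)
      show "edge_connected (?k * (p - 1)) ?V E ?g"
        unfolding edge_connected_def
      proof (intro allI impI)
        fix X assume X: "X \<subseteq> ?V \<and> X \<noteq> {} \<and> X \<noteq> ?V"
        let ?X = "if w \<in> X then X \<union> S else X - S"
        have "cut E ?g X = cut E g ?X" by (rule cut_contract_point[OF w])
        then have "card (edge_cut E ?g X) = card (edge_cut E g ?X)" by (simp add: cut_def)
        moreover have "?X \<subseteq> V \<and> ?X \<noteq> {} \<and> ?X \<noteq> V"
        proof (cases "w \<in> X")
          case True
          then have "\<exists>v\<in>V - S. v \<notin> X" using X by auto
          then show ?thesis using True X S w by auto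
        next
          case False
          then have "X - S = X" "X \<subseteq> V - S" using X by auto
          then show ?thesis using False X S w by auto
        qed
        ultimately show "?k * (p - 1) \<le> card (edge_cut E ?g X)"
          using con unfolding edge_connected_def by metis
      qed
      have "sum ?\<beta> ?V = sum \<beta> S + sum \<beta> (V - S)"
      proof -
        have "sum ?\<beta> ?V = ?\<beta> w + sum ?\<beta> (V - S)" using w fV by simp
        moreover have "sum ?\<beta> (V - S) = sum \<beta> (V - S)" using w by (intro sum.cong) auto
        ultimately show ?thesis by simp
      qed
      also have "\<dots> = sum \<beta> V" using sum.subset_diff[OF S(1) fV, of \<beta>] by simp
      finally show "int p dvd sum ?\<beta> ?V" using \<beta> by simp
    qed
    then obtain s where s: "signs E s"
      "\<And>x. x \<in> ?V \<Longrightarrow> int p dvd outflow E ?g (\<lambda>e. s e * f e) {x} - ?\<beta> x" by blast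
    let ?s = "\<lambda>e. s e * f e"
    have sS: "int p dvd outflow E g ?s S - sum \<beta> S"
      using s(2)[of w] w by (simp add: outflow_contract_point insert_absorb)
    have split: "outflow E g r X = outflow (E - F) g r X + outflow F g r X" for r X
      unfolding outflow_def using sum.subset_diff[OF fF(2) fE] by blast
    have inS: "outflow F g r S = 0" for r using Fends by (simp add: outflow_def)
    have off: "outflow F g r {x} = 0" if "x \<notin> S" for r x
      unfolding outflow_def using Fends that by (intro sum.neutral) auto
    \<comment> \<open>What the edges of \<open>F\<close> still have to supply at \<open>x\<close>
      when all other edges keep the signs found in the contracted graph.\<close>
    define \<gamma> where "\<gamma> x = \<beta> x - outflow (E - F) g ?s {x}" for x
    have "coprime c (int p)"
    proof -
      have "\<not> int p dvd c" using c zdvd_not_zless by auto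
      then show ?thesis using p(1) by (metis coprime_commute prime_imp_coprime prime_nat_int_transfer)
    qed
    \<comment> \<open>\<open>u\<close> inverts \<open>c\<close> modulo p, which turns the request
      into an unweighted one.\<close>
    then obtain u v where uv: "u * c + v * int p = 1" using bezout_int[of c "int p"] by auto
    have uc: "int p dvd c * u - 1" using uv by (intro dvdI[of _ _ "- v"]) (simp add: algebra_simps)
    \<comment> \<open>\<open>F\<close> lies inside \<open>S\<close>, so the outflow of
      \<open>S\<close> does not depend on it.\<close>
    have "sum \<gamma> S = sum \<beta> S - outflow E g ?s S"
      unfolding \<gamma>_def sum_subtractf using outflow_singletons[OF fS, of "E - F" g ?s] split inS by simp
    then have "int p dvd sum \<gamma> S" using sS by (metis dvd_minus_iff minus_diff_eq)
    then have "int p dvd (\<Sum>x\<in>S. u * \<gamma> x)" unfolding sum_distrib_left[symmetric] by simp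
    moreover have "6 * int p - 7 \<le> cut F g A" if "A \<subseteq> S" "A \<noteq> {}" "A \<noteq> S" for A
      using cutS[OF that] p(2) unfolding F_def[symmetric] by (simp add: cut_def)
    ultimately obtain r where r: "signs F r" "\<And>x. x \<in> S \<Longrightarrow> int p dvd outflow F g r {x} - u * \<gamma> x"
      using modulo_orientation[of "int p" S F g "\<lambda>x. u * \<gamma> x"] p(2) oddp fS fF(1) Fends by auto
    \<comment> \<open>Modulo p, weight p - c acts like weight c on the reversed edge.\<close>
    define s' where "s' e = (if e \<in> F then (if f e = c then r e else - r e) else s e)" for e
    have "signs E s'" using s(1) r(1) by (auto simp: signs_def s'_def)
    moreover have "int p dvd outflow E g (\<lambda>e. s' e * f e) {x} - \<beta> x" if x: "x \<in> V" for x
    proof -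
      have EF: "outflow (E - F) g (\<lambda>e. s' e * f e) {x} = outflow (E - F) g ?s {x}"
        by (intro outflow_cong) (auto simp: s'_def)
      show ?thesis
      proof (cases "x \<in> S")
        case False
        have "outflow E g (\<lambda>e. s' e * f e) {x} = outflow E g ?s {x}"
          unfolding split[of _ "{x}"] off[OF False] EF ..
        also have "\<dots> = outflow E ?g ?s {x}"
        proof -
          have "w \<notin> {x}" "{x} - S = {x}" using False w by auto
          then show ?thesis using outflow_contract_point[OF w, of E g ?s "{x}"] by simp
        qed
        finally have o: "outflow E g (\<lambda>e. s' e * f e) {x} = outflow E ?g ?s {x}" .
        have "x \<noteq> w" using False w by auto
        then show ?thesis unfolding o using s(2)[of x] x False by simp
      next
        case True
        have a: "int p dvd outflow F g (\<lambda>e. s' e * f e) {x} - c * outflow F g r {x}"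
          unfolding outflow_def sum_distrib_left sum_subtractf[symmetric]
        proof (rule dvd_sum)
          fix e assume e: "e \<in> F"
          have "f e = c \<or> f e = int p - c" using e by (auto simp: F_def inner_def M_def)
          then have "s' e * f e - c * r e = (if f e = c then 0 else - r e * int p)"
            using e by (auto simp: s'_def left_diff_distrib right_diff_distrib)
          then have "int p dvd s' e * f e - c * r e" by simp
          then have "int p dvd (s' e * f e - c * r e) * (of_bool (fst (g e) \<in> {x}) - of_bool (snd (g e) \<in> {x}))"
            by (rule dvd_mult2)
          then show "int p dvd s' e * f e * (of_bool (fst (g e) \<in> {x}) - of_bool (snd (g e) \<in> {x})) -
             c * (r e * (of_bool (fst (g e) \<in> {x}) - of_bool (snd (g e) \<in> {x})))"
            by (simp add: algebra_simps)
        qed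
        have b: "int p dvd c * (outflow F g r {x} - u * \<gamma> x)" using r(2)[OF True] by simp
        have d: "int p dvd (c * u - 1) * \<gamma> x" using uc by simp
        have "outflow E g (\<lambda>e. s' e * f e) {x} - \<beta> x =
          (outflow F g (\<lambda>e. s' e * f e) {x} - c * outflow F g r {x}) +
          c * (outflow F g r {x} - u * \<gamma> x) + (c * u - 1) * \<gamma> x"
          unfolding split[of _ "{x}"] EF \<gamma>_def by (simp add: algebra_simps)
        then show ?thesis using dvd_add[OF dvd_add[OF a b] d] by metis
      qed
    qed
    ultimately show ?thesis by blast
  qed
qed

lemma boundary_of_outflow:
  assumes "finite E" "signs E s"
  shows "boundary_of E (\<lambda>e. if s e = 1 then g e else prod.swap (g e)) f v = outflow E g (\<lambda>e. s e * f e) {v}"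
proof -
  have "boundary_of E (\<lambda>e. if s e = 1 then g e else prod.swap (g e)) f v =
    (\<Sum>e\<in>E. (if fst (if s e = 1 then g e else prod.swap (g e)) = v then f e else 0)
       - (if snd (if s e = 1 then g e else prod.swap (g e)) = v then f e else 0))"
    unfolding boundary_of_def sum_subtractf using assms(1) by (simp only: sum.inter_filter)
  also have "\<dots> = outflow E g (\<lambda>e. s e * f e) {v}"
    unfolding outflow_def using assms(2) by (intro sum.cong) (auto simp: signs_def)
  finally show ?thesis .
qed

theorem theorem7:
  fixes V :: "'v set" and E :: "'e set" and ends :: "'e \<Rightarrow> 'v \<times> 'v"
    and p :: nat and f :: "'e \<Rightarrow> int" and \<beta> :: "'v \<Rightarrow> int"
  assumes "prime p" and "p \<ge> 3"
    and "multigraph V E ends"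
    and "edge_connected ((6 * p - 8) * (p - 1)) V E ends"
    and "\<forall>e\<in>E. f e \<in> {1..<int p}"
    and "is_Zk_boundary (int p) V \<beta>"
  shows "\<exists>D. weighted_beta_orientation (int p) V E ends f \<beta> D"
proof -
  have fin: "finite V" "finite E" and ends: "\<And>e. e \<in> E \<Longrightarrow> fst (ends e) \<in> V \<and> snd (ends e) \<in> V"
    using assms(3) by (auto simp: multigraph_def)
  have "int p dvd sum \<beta> V" using assms(6) by (auto simp: is_Zk_boundary_def)
  from weighted_orientation[OF assms(1,2) fin(2) _ fin(1) ends assms(4) this, of f] assms(5)
  obtain s where s: "signs E s"
    "\<And>x. x \<in> V \<Longrightarrow> int p dvd outflow E ends (\<lambda>e. s e * f e) {x} - \<beta> x" by blast
  have "weighted_beta_orientation (int p) V E ends f \<beta> (\<lambda>e. if s e = 1 then ends e else prod.swap (ends e))"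
    unfolding weighted_beta_orientation_def is_orientation_def boundary_of_outflow[OF fin(2) s(1)]
    using s(2) by (auto simp: mod_eq_dvd_iff)
  then show ?thesis by blast
qed

end
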